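(* Let $k$ be an algebraically closed field and $Q_3$ the $3$-Kronecker quiver (two vertices $x,y$, three arrows from $x$ to $y$). For $j\ge0$ let $U^{(j)}_{Q_3}(3,3)\subseteq (k^{3\times 3})^3$ be the set of all triples $m=(m_1,m_2,m_3)$ of $3\times3$-matrices such that the corresponding $Q_3$-representation $\operatorname{rep}m$ of dimension vector $(3,3)$ is indecomposable and $\dim_k\operatorname{End}_{Q_3}(\operatorname{rep}m)=j$. Then $U^{(j)}_{Q_3}(3,3)$ is irreducible for $j=1,2,3$, and $U^{(j)}_{Q_3}(3,3)=\emptyset$ for all $j\ge4$.
   Context: For $m=(m_1,m_2,m_3)$, $\operatorname{rep}m$ is the representation with $k^3$ at both vertices and the three arrows represented by $m_1,m_2,m_3$. Irreducibility refers to the Zariski topology on the affine space $(k^{3\times3})^3$ (with $U^{(j)}_{Q_3}(3,3)$, a locally closed subset, carrying the induced topology). *)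

theory Defs
  imports "HOL-Analysis.Analysis"
begin

section \<open>Representations of Kronecker quivers\<close>

text \<open>
  The Kronecker quiver has two vertices $x$, $y$ and a finite type \<^typ>\<open>'r\<close> of arrows from $x$ to
  $y$, so the quiver $Q_3$ is the case of the three-element arrow type \<^typ>\<open>3\<close>. We only consider
  representations with $k^n$ at $x$ and $k^m$ at $y$; such a representation is the family of linear
  maps attached to the arrows. Note that \<open>'a^'n^'m\<close> is the type of \<open>m\<times>n\<close>-matrices, acting
  \<open>'a^'n \<Rightarrow> 'a^'m\<close>.
\<close>

definition rep :: "'a::field^'n^'m^'r \<Rightarrow> 'r \<Rightarrow> 'a^'n \<Rightarrow> 'a^'m" where
  "rep m a = (\<lambda>v. m $ a *v v)"

definition subrep :: "('r \<Rightarrow> 'a::field^'n \<Rightarrow> 'a^'m) \<Rightarrow> ('a^'n) set \<Rightarrow> ('a^'m) set \<Rightarrow> bool" where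
  "subrep M V W \<longleftrightarrow> vec.subspace V \<and> vec.subspace W \<and> (\<forall>a. M a ` V \<subseteq> W)"

definition direct_decomposition :: "('a::field^'n) set \<Rightarrow> ('a^'n) set \<Rightarrow> bool" where
  "direct_decomposition V V' \<longleftrightarrow> V \<inter> V' = {0} \<and> {v + v' | v v'. v \<in> V \<and> v' \<in> V'} = UNIV"

text \<open>
  A representation is indecomposable if it is nonzero and not the direct sum of two nonzero
  subrepresentations. The condition of being nonzero is automatic below, since index types are
  nonempty and hence \<open>'a^'n\<close> is a nonzero space.
\<close>

definition indecomposable_rep :: "('r \<Rightarrow> 'a::field^'n \<Rightarrow> 'a^'m) \<Rightarrow> bool" where
  "indecomposable_rep M \<longleftrightarrow>
     (\<forall>V W V' W'. subrep M V W \<and> subrep M V' W' \<and>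
        direct_decomposition V V' \<and> direct_decomposition W W' \<longrightarrow>
        (V = {0} \<and> W = {0}) \<or> (V' = {0} \<and> W' = {0}))"

text \<open>
  An endomorphism is a pair of linear maps, one at each vertex, commuting with the arrows. Linear
  endomorphisms of $k^n$ are given by their matrices.
\<close>

definition End_rep :: "('r \<Rightarrow> 'a::field^'n \<Rightarrow> 'a^'m) \<Rightarrow> (('a^'n^'n) \<times> ('a^'m^'m)) set" where
  "End_rep M = {(A, B). \<forall>a v. B *v M a v = M a (A *v v)}"

definition scale_pair ::
    "'a::field \<Rightarrow> ('a^'n^'n) \<times> ('a^'m^'m) \<Rightarrow> ('a^'n^'n) \<times> ('a^'m^'m)" where
  "scale_pair c p = ((\<chi> i. c *s (fst p $ i)), (\<chi> i. c *s (snd p $ i)))"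

global_interpretation mat_pair: vector_space
  "scale_pair :: 'a::field \<Rightarrow> ('a^'n^'n) \<times> ('a^'m^'m) \<Rightarrow> ('a^'n^'n) \<times> ('a^'m^'m)"
  by unfold_locales
    (simp_all add: scale_pair_def vec_eq_iff prod_eq_iff vector_add_component algebra_simps)

lemma subspace_End_rep: "mat_pair.subspace (End_rep (rep m))"
  unfolding mat_pair.subspace_def End_rep_def rep_def
proof (intro conjI ballI allI)
  have *: "(\<chi> i. c *s (A $ i)) *v w = c *s (A *v w)" for c and A :: "'a^'k^'l" and w
    by (simp add: matrix_vector_mult_def vec_eq_iff sum_distrib_left mult.assoc)
  show "scale_pair c p \<in> {(A, B). \<forall>a v. B *v (m $ a *v v) = m $ a *v (A *v v)}"
    if "p \<in> {(A, B). \<forall>a v. B *v (m $ a *v v) = m $ a *v (A *v v)}" for c p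
    using that by (auto simp: scale_pair_def * vec.scale)
qed (auto simp: zero_prod_def matrix_vector_mult_add_rdistrib matrix_vector_right_distrib)


section \<open>The Zariski topology\<close>

text \<open>
  Polynomial functions on the affine space of tuples of matrices: the $k$-algebra of functions
  generated by the coordinates.
\<close>

inductive polynomial_fun :: "('a::field^'n^'m^'r \<Rightarrow> 'a) \<Rightarrow> bool" where
  const: "polynomial_fun (\<lambda>_. c)"
| coord: "polynomial_fun (\<lambda>m. m $ a $ i $ j)"
| add: "polynomial_fun f \<Longrightarrow> polynomial_fun g \<Longrightarrow> polynomial_fun (\<lambda>m. f m + g m)"
| mult: "polynomial_fun f \<Longrightarrow> polynomial_fun g \<Longrightarrow> polynomial_fun (\<lambda>m. f m * g m)"

definition zero_locus :: "('b \<Rightarrow> 'a::zero) set \<Rightarrow> 'b set" where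
  "zero_locus S = {m. \<forall>f\<in>S. f m = 0}"

definition zariski_closed :: "('a::field^'n^'m^'r) set \<Rightarrow> bool" where
  "zariski_closed Z \<longleftrightarrow> (\<exists>S. S \<subseteq> Collect polynomial_fun \<and> Z = zero_locus S)"

definition zariski :: "('a::field^'n^'m^'r) topology" where
  "zariski = topology (\<lambda>U. zariski_closed (- U))"

lemma zariski_closed_Un:
  assumes "zariski_closed Y" "zariski_closed Z"
  shows "zariski_closed (Y \<union> Z)"
proof -
  obtain S T where S: "S \<subseteq> Collect polynomial_fun" "Y = zero_locus S"
    and T: "T \<subseteq> Collect polynomial_fun" "Z = zero_locus T"
    using assms unfolding zariski_closed_def by blast
  let ?P = "{(\<lambda>m. f m * g m) | f g. f \<in> S \<and> g \<in> T}"
  have "?P \<subseteq> Collect polynomial_fun"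
    using S(1) T(1) polynomial_fun.mult by blast
  moreover have "Y \<union> Z = zero_locus ?P"
    unfolding S(2) T(2) zero_locus_def by fastforce
  ultimately show ?thesis
    unfolding zariski_closed_def by blast
qed

lemma zariski_closed_Inter:
  assumes "\<And>Z. Z \<in> \<Z> \<Longrightarrow> zariski_closed Z"
  shows "zariski_closed (\<Inter>\<Z>)"
proof -
  obtain S where S: "\<And>Z. Z \<in> \<Z> \<Longrightarrow> S Z \<subseteq> Collect polynomial_fun \<and> Z = zero_locus (S Z)"
    using assms unfolding zariski_closed_def by metis
  have "\<Inter>\<Z> = (\<Inter>Z\<in>\<Z>. zero_locus (S Z))"
    using S by auto
  also have "\<dots> = zero_locus (\<Union>Z\<in>\<Z>. S Z)"
    unfolding zero_locus_def by auto
  finally have "\<Inter>\<Z> = zero_locus (\<Union>Z\<in>\<Z>. S Z)" .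
  moreover have "(\<Union>Z\<in>\<Z>. S Z) \<subseteq> Collect polynomial_fun"
    using S by blast
  ultimately show ?thesis
    unfolding zariski_closed_def by blast
qed

lemma istopology_zariski: "istopology (\<lambda>U::('a::field^'n^'m^'r) set. zariski_closed (- U))"
  unfolding istopology_def
proof (intro conjI allI impI)
  fix U V :: "('a^'n^'m^'r) set"
  assume "zariski_closed (- U)" "zariski_closed (- V)"
  then show "zariski_closed (- (U \<inter> V))"
    using zariski_closed_Un by (simp add: Compl_Int)
next
  fix \<U> :: "('a^'n^'m^'r) set set"
  assume "\<forall>U\<in>\<U>. zariski_closed (- U)"
  then have "zariski_closed (\<Inter>(uminus ` \<U>))"
    by (intro zariski_closed_Inter) auto
  then show "zariski_closed (- \<Union>\<U>)"
    by (metis Compl_eq uminus_Sup)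
qed

lemma openin_zariski: "openin zariski U \<longleftrightarrow> zariski_closed (- U)"
  unfolding zariski_def by (simp add: topology_inverse'[OF istopology_zariski])

lemma topspace_zariski [simp]: "topspace zariski = UNIV"
proof -
  have "zariski_closed {}"
    unfolding zariski_closed_def zero_locus_def
    by (rule exI[of _ "{\<lambda>_. 1}"]) (auto intro: polynomial_fun.const)
  then have "openin zariski UNIV"
    by (simp add: openin_zariski)
  then show ?thesis
    by (metis openin_subset top.extremum_uniqueI)
qed

lemma closedin_zariski: "closedin zariski Z \<longleftrightarrow> zariski_closed Z"
  by (simp add: closedin_def openin_zariski Compl_eq_Diff_UNIV[symmetric])

definition irreducible_space :: "'b topology \<Rightarrow> bool" where
  "irreducible_space X \<longleftrightarrow> topspace X \<noteq> {} \<and>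
     (\<forall>C D. closedin X C \<and> closedin X D \<and> C \<union> D = topspace X \<longrightarrow>
        C = topspace X \<or> D = topspace X)"


section \<open>Indecomposables with fixed endomorphism dimension\<close>

definition U_Q3 :: "nat \<Rightarrow> ('a::field^3^3^3) set" where
  "U_Q3 j = {m. indecomposable_rep (rep m) \<and> mat_pair.dim (End_rep (rep m)) = j}"

end

theory Submission
  imports Defs
begin

text \<open>
  Let $H_N$ be the set of triples conjugate, by invertible matrices at the two vertices, to a triple
  commuting with the fixed matrix $N$. It is swept out by a linear space under a group that is open
  in a linear space, so any two of its points are joined by a curve with polynomial coordinates that
  stays in $H_N$ up to finitely many parameters. Since $\dim \mathrm{End}$ is upper semicontinuous
  along such curves, $H_N \cap \{\dim \mathrm{End} \le j\}$ is irreducible.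

  Over an algebraically closed field every endomorphism of an indecomposable is a scalar plus a
  nilpotent one, and a nilpotent one that vanishes at one vertex is zero. This gives
  $U^{(1)} = H_1 \cap \{\dim \le 1\}$ and $U^{(2)} = H_{E_{13}} \cap \{\dim \le 2\}$.
  With $J$ the nilpotent Jordan block, $H_J \cap \{\dim \le 3\}$ is contained in $U^{(3)}$ and
  indecomposables in $H_J$ have $\dim \mathrm{End} \le 3$. The remaining indecomposables with
  $\dim \mathrm{End} \ge 3$ have only square-zero nilpotent endomorphisms; they fall into three
  families, related to each other by permuting the factors of
  $k^3 \otimes k^3 \otimes k^3$. All of them have $\dim \mathrm{End} = 3$, and each lies on a line
  whose other points belong to $H_J$. So $H_J \cap \{\dim \le 3\}$ is dense in $U^{(3)}$.
\<close>

section \<open>Irreducibility along polynomial curves\<close>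

text \<open>Polynomiality is a predicate on functions rather than a choice of an element of
  \<open>'a poly\<close>, so that matrix entries depending on a parameter are handled by closure
  rules.\<close>

definition is_poly :: "('a::field \<Rightarrow> 'a) \<Rightarrow> bool" where
  "is_poly h \<longleftrightarrow> (\<exists>p. \<forall>t. h t = poly p t)"

lemma is_poly_const: "is_poly (\<lambda>t. c)"
  unfolding is_poly_def by (rule exI[of _ "[:c:]"]) simp

lemma is_poly_ident: "is_poly (\<lambda>t. t)"
  unfolding is_poly_def by (rule exI[of _ "[:0, 1:]"]) simp

lemma is_poly_add: "is_poly f \<Longrightarrow> is_poly g \<Longrightarrow> is_poly (\<lambda>t. f t + g t)"
  unfolding is_poly_def by (metis poly_add)

lemma is_poly_diff: "is_poly f \<Longrightarrow> is_poly g \<Longrightarrow> is_poly (\<lambda>t. f t - g t)"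
  unfolding is_poly_def by (metis poly_diff)

lemma is_poly_mult: "is_poly f \<Longrightarrow> is_poly g \<Longrightarrow> is_poly (\<lambda>t. f t * g t)"
  unfolding is_poly_def by (metis poly_mult)

lemma is_poly_sum: "(\<And>i. i \<in> I \<Longrightarrow> is_poly (f i)) \<Longrightarrow> is_poly (\<lambda>t. \<Sum>i\<in>I. f i t)"
  by (induction I rule: infinite_finite_induct) (auto intro: is_poly_const is_poly_add)

lemma is_poly_prod: "(\<And>i. i \<in> I \<Longrightarrow> is_poly (f i)) \<Longrightarrow> is_poly (\<lambda>t. \<Prod>i\<in>I. f i t)"
  by (induction I rule: infinite_finite_induct) (auto intro: is_poly_const is_poly_mult)

lemma is_poly_if: "is_poly f \<Longrightarrow> is_poly g \<Longrightarrow> is_poly (\<lambda>t. if b then f t else g t)"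
  by (cases b) simp_all

lemmas is_poly_intros =
  is_poly_const is_poly_ident is_poly_add is_poly_diff is_poly_mult is_poly_sum is_poly_prod

lemma finite_zeros_is_poly:
  assumes "is_poly h" "h s \<noteq> 0"
  shows "finite {t. h t = 0}"
proof -
  obtain p where p: "\<And>t. h t = poly p t"
    using assms(1) unfolding is_poly_def by blast
  then have "p \<noteq> 0"
    using assms(2) by auto
  then show ?thesis
    using poly_roots_finite p by auto
qed

lemma is_poly_det:
  assumes "\<And>i j. is_poly (\<lambda>t. M t $ i $ j)"
  shows "is_poly (\<lambda>t. det (M t :: 'a::field^'n^'n))"
  unfolding det_def by (intro is_poly_intros assms)

lemma is_poly_matrix_mult:
  assumes "\<And>i j. is_poly (\<lambda>t. M t $ i $ j)" "\<And>i j. is_poly (\<lambda>t. N t $ i $ j)"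
  shows "is_poly (\<lambda>t. ((M t :: 'a::field^'n^'m) ** (N t :: 'a^'k^'n)) $ i $ j)"
  by (simp add: matrix_matrix_mult_def) (intro is_poly_intros assms)

text \<open>In a finite field, 1 plus the product of all X - a has positive degree and no
  root.\<close>

lemma infinite_UNIV_alg_closed: "infinite (UNIV :: 'a::alg_closed_field set)"
proof
  assume fin: "finite (UNIV :: 'a set)"
  let ?q = "\<Prod>a\<in>(UNIV::'a set). [:- a, 1:]"
  have "degree ?q = card (UNIV :: 'a set)"
    by (subst degree_prod_eq_sum_degree) auto
  moreover have "card (UNIV :: 'a set) > 0"
    using fin by (simp add: finite_UNIV_card_ge_0)
  ultimately have "degree (1 + ?q) > 0"
    by (subst degree_add_eq_right) auto
  then obtain x where "poly (1 + ?q) x = 0"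
    using alg_closed_imp_poly_has_root by blast
  moreover have "poly ?q x = 0"
    using fin by (simp add: poly_prod prod_zero_iff)
  ultimately show False
    by simp
qed

section \<open>Polynomial curves and the irreducibility criterion\<close>

definition poly_curve :: "('a::field \<Rightarrow> 'a^'n^'m^'r) \<Rightarrow> bool" where
  "poly_curve \<gamma> \<longleftrightarrow> (\<forall>a i j. is_poly (\<lambda>t. \<gamma> t $ a $ i $ j))"

lemma is_poly_along_curve:
  assumes "polynomial_fun f" "poly_curve \<gamma>"
  shows "is_poly (\<lambda>t. f (\<gamma> t))"
  using assms(1)
  by induction (use assms(2) in \<open>auto simp: poly_curve_def intro: is_poly_intros\<close>)

text \<open>The condition \<open>sep\<close> says that two nonempty basic open subsets of
  \<open>S\<close> meet. If proper closed subsets \<open>C\<close> and \<open>D\<close> covered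
  \<open>S\<close>, some \<open>f\<close> vanishing on \<open>C\<close> and some \<open>g\<close>
  vanishing on \<open>D\<close> would be nonzero somewhere on \<open>S\<close>, and a common point
  of their nonvanishing loci would lie outside both.\<close>

lemma irreducible_spaceI_poly:
  fixes S :: "('a::field^'n^'m^'r) set"
  assumes "S \<noteq> {}"
    and sep: "\<And>f g x y. polynomial_fun f \<Longrightarrow> polynomial_fun g \<Longrightarrow> x \<in> S \<Longrightarrow> y \<in> S \<Longrightarrow>
      f x \<noteq> 0 \<Longrightarrow> g y \<noteq> 0 \<Longrightarrow> \<exists>z\<in>S. f z \<noteq> 0 \<and> g z \<noteq> 0"
  shows "irreducible_space (subtopology zariski S)"
  unfolding irreducible_space_def
proof (intro conjI allI impI)
  show "topspace (subtopology zariski S) \<noteq> {}"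
    using assms(1) by simp
next
  fix C D
  assume "closedin (subtopology zariski S) C \<and> closedin (subtopology zariski S) D \<and>
    C \<union> D = topspace (subtopology zariski S)"
  then obtain F G where F: "F \<subseteq> Collect polynomial_fun" "C = zero_locus F \<inter> S"
    and G: "G \<subseteq> Collect polynomial_fun" "D = zero_locus G \<inter> S" and un: "C \<union> D = S"
    by (auto simp: closedin_subtopology closedin_zariski zariski_closed_def)
  have "C = S \<or> D = S"
  proof (rule ccontr)
    assume "\<not> ?thesis"
    then obtain x y f g where "x \<in> S" "y \<in> S" "f \<in> F" "g \<in> G" "f x \<noteq> 0" "g y \<noteq> 0"
      using F(2) G(2) by (auto simp: zero_locus_def)
    moreover from this have "polynomial_fun f" "polynomial_fun g"
      using F(1) G(1) by auto
    ultimately obtain z where "z \<in> S" "f z \<noteq> 0" "g z \<noteq> 0"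
      using sep by metis
    moreover from this(2,3) have "z \<notin> C" "z \<notin> D"
      unfolding F(2) G(2) zero_locus_def using \<open>f \<in> F\<close> \<open>g \<in> G\<close> by blast+
    ultimately show False
      using un by blast
  qed
  then show "C = topspace (subtopology zariski S) \<or> D = topspace (subtopology zariski S)"
    by simp
qed

text \<open>A polynomial function that is nonzero at one parameter of a curve vanishes at only
  finitely many others, and the field is infinite. So \<open>dense\<close> moves points of
  \<open>S\<close> into \<open>T\<close>, and a curve joining two points of \<open>T\<close>
  contains a point of \<open>T\<close> where \<open>f\<close> and \<open>g\<close> are both
  nonzero.\<close>

lemma irreducible_space_by_curves:
  fixes S T :: "('a::alg_closed_field^'n^'m^'r) set"
  assumes "T \<noteq> {}" "T \<subseteq> S"
    and conn: "\<And>x y. x \<in> T \<Longrightarrow> y \<in> T \<Longrightarrow>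
      \<exists>\<gamma>. poly_curve \<gamma> \<and> \<gamma> 0 = x \<and> \<gamma> 1 = y \<and> finite {t. \<gamma> t \<notin> T}"
    and dense: "\<And>x. x \<in> S \<Longrightarrow> \<exists>\<gamma>. poly_curve \<gamma> \<and> \<gamma> 0 = x \<and> finite {t. \<gamma> t \<notin> T}"
  shows "irreducible_space (subtopology zariski S)"
proof (rule irreducible_spaceI_poly)
  show "S \<noteq> {}"
    using assms by blast
next
  have move: "\<exists>z\<in>T. f z \<noteq> 0"
    if "x \<in> S" "polynomial_fun f" "f x \<noteq> 0" for x f
  proof -
    obtain \<gamma> where \<gamma>: "poly_curve \<gamma>" "\<gamma> 0 = x" "finite {t. \<gamma> t \<notin> T}"
      using dense \<open>x \<in> S\<close> by blast
    have "finite {t. f (\<gamma> t) = 0}"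
      using finite_zeros_is_poly[OF is_poly_along_curve[OF that(2) \<gamma>(1)], of 0] \<gamma>(2) that(3) by simp
    then have "finite ({t. f (\<gamma> t) = 0} \<union> {t. \<gamma> t \<notin> T})"
      using \<gamma>(3) by (intro finite_UnI)
    from ex_new_if_finite[OF infinite_UNIV_alg_closed this]
    obtain t where "f (\<gamma> t) \<noteq> 0" "\<gamma> t \<in> T"
      by auto
    then show ?thesis by (intro bexI[of _ "\<gamma> t"])
  qed
  fix f g x y
  assume fg: "polynomial_fun f" "polynomial_fun g" and "x \<in> S" "y \<in> S" "f x \<noteq> 0" "g y \<noteq> 0"
  then obtain x' y' where xy: "x' \<in> T" "y' \<in> T" "f x' \<noteq> 0" "g y' \<noteq> 0"
    using move[of x f] move[of y g] by auto
  then obtain \<gamma> where \<gamma>: "poly_curve \<gamma>" "\<gamma> 0 = x'" "\<gamma> 1 = y'" "finite {t. \<gamma> t \<notin> T}"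
    using conn by blast
  have "finite {t. f (\<gamma> t) = 0}"
    using finite_zeros_is_poly[OF is_poly_along_curve[OF fg(1) \<gamma>(1)], of 0] \<gamma>(2) xy(3) by simp
  moreover have "finite {t. g (\<gamma> t) = 0}"
    using finite_zeros_is_poly[OF is_poly_along_curve[OF fg(2) \<gamma>(1)], of 1] \<gamma>(3) xy(4) by simp
  ultimately have "finite ({t. f (\<gamma> t) = 0} \<union> {t. g (\<gamma> t) = 0} \<union> {t. \<gamma> t \<notin> T})"
    using \<gamma>(4) by (intro finite_UnI)
  from ex_new_if_finite[OF infinite_UNIV_alg_closed this]
  obtain t where "f (\<gamma> t) \<noteq> 0" "g (\<gamma> t) \<noteq> 0" "\<gamma> t \<in> T"
    by auto
  then show "\<exists>z\<in>S. f z \<noteq> 0 \<and> g z \<noteq> 0"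
    using \<open>T \<subseteq> S\<close> by (intro bexI[of _ "\<gamma> t"]) auto
qed

section \<open>Endomorphisms as the kernel of a matrix\<close>

lemma End_rep_iff:
  "(A, B) \<in> End_rep (rep m) \<longleftrightarrow> (\<forall>a. B ** m $ a = m $ a ** A)"
  unfolding End_rep_def rep_def
  by (simp add: matrix_vector_mul_assoc) (metis matrix_eq)

text \<open>Coordinates on pairs of matrices: they carry the standard basis over to the space of
  pairs and turn endomorphism spaces into kernels of matrices.\<close>

definition pair_of_vec ::
    "'a::field^(('n::finite \<times> 'n) + ('m::finite \<times> 'm)) \<Rightarrow> ('a^'n^'n) \<times> ('a^'m^'m)" where
  "pair_of_vec x = ((\<chi> i j. x $ Inl (i, j)), (\<chi> i j. x $ Inr (i, j)))"

lemma bij_pair_of_vec: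
  "bij (pair_of_vec :: 'a::field^(('n::finite \<times> 'n) + ('m::finite \<times> 'm)) \<Rightarrow> _)"
proof (rule bijI)
  show "inj (pair_of_vec :: 'a::field^(('n::finite \<times> 'n) + ('m::finite \<times> 'm)) \<Rightarrow> _)"
  proof (rule injI)
    fix x y :: "'a::field^(('n::finite \<times> 'n) + ('m::finite \<times> 'm))"
    assume eq: "pair_of_vec x = pair_of_vec y"
    have "x $ k = y $ k" for k
    proof (cases k)
      case (Inl p)
      then show ?thesis
        using arg_cong[OF eq, of "\<lambda>p'. fst p' $ fst p $ snd p"] by (simp add: pair_of_vec_def)
    next
      case (Inr p)
      then show ?thesis
        using arg_cong[OF eq, of "\<lambda>p'. snd p' $ fst p $ snd p"] by (simp add: pair_of_vec_def)
    qed
    then show "x = y" by (simp add: vec_eq_iff)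
  qed
  show "surj (pair_of_vec :: 'a::field^(('n::finite \<times> 'n) + ('m::finite \<times> 'm)) \<Rightarrow> _)"
  proof (rule surjI)
    fix p
    show "pair_of_vec (\<chi> k. case k of Inl (i, j) \<Rightarrow> fst p $ i $ j | Inr (i, j) \<Rightarrow> snd p $ i $ j) = p"
      by (simp add: pair_of_vec_def prod_eq_iff vec_eq_iff)
  qed
qed

interpretation pv: vector_space_pair
  "(*s) :: 'a::field \<Rightarrow> 'a^(('n::finite \<times> 'n) + ('m::finite \<times> 'm)) \<Rightarrow> _"
  "scale_pair :: 'a \<Rightarrow> ('a^'n^'n) \<times> ('a^'m^'m) \<Rightarrow> _"
  by unfold_locales

lemma linear_pair_of_vec:
  "Vector_Spaces.linear (*s) scale_pair
     (pair_of_vec :: 'a::field^(('n::finite \<times> 'n) + ('m::finite \<times> 'm)) \<Rightarrow> _)"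
  by unfold_locales
    (simp_all add: pair_of_vec_def scale_pair_def vec_eq_iff prod_eq_iff)

interpretation pfd: finite_dimensional_vector_space
  "scale_pair :: 'a::field \<Rightarrow> ('a^'n^'n) \<times> ('a^'m^'m) \<Rightarrow> _"
  "pair_of_vec ` (cart_basis :: ('a^(('n::finite \<times> 'n) + ('m::finite \<times> 'm))) set)"
proof unfold_locales
  show "finite (pair_of_vec ` (cart_basis :: ('a^(('n::finite \<times> 'n) + ('m::finite \<times> 'm))) set))"
    by (simp add: finite_cart_basis)
  show "mat_pair.independent (pair_of_vec ` (cart_basis :: ('a^(('n::finite \<times> 'n) + ('m::finite \<times> 'm))) set))"
    by (rule pv.linear_independent_injective_image[OF linear_pair_of_vec independent_cart_basis])
      (meson bij_pair_of_vec bij_is_inj inj_on_subset subset_UNIV)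
  show "mat_pair.span (pair_of_vec ` (cart_basis :: ('a^(('n::finite \<times> 'n) + ('m::finite \<times> 'm))) set)) = UNIV"
    by (subst pv.linear_span_image[OF linear_pair_of_vec])
      (simp add: bij_is_surj bij_pair_of_vec)
qed

interpretation pvfd: finite_dimensional_vector_space_pair
  "(*s) :: 'a::field \<Rightarrow> 'a^(('n::finite \<times> 'n) + ('m::finite \<times> 'm)) \<Rightarrow> _" cart_basis
  "scale_pair :: 'a \<Rightarrow> ('a^'n^'n) \<times> ('a^'m^'m) \<Rightarrow> _"
  "pair_of_vec ` (cart_basis :: ('a^(('n::finite \<times> 'n) + ('m::finite \<times> 'm))) set)"
  by unfold_locales

text \<open>In the coordinates of \<open>pair_of_vec\<close>, this is the matrix of the linear map
  sending (A, B) to the family B m_a - m_a A.\<close>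

definition End_matrix ::
    "'a::field^'n^'m^'r \<Rightarrow> 'a^(('n::finite \<times> 'n) + ('m::finite \<times> 'm))^('r::finite \<times> 'm \<times> 'n)" where
  "End_matrix m = (\<chi> r k. case r of (a, i, j) \<Rightarrow> (case k of
      Inl (k, l) \<Rightarrow> (if l = j then - (m $ a $ i $ k) else 0)
    | Inr (k, l) \<Rightarrow> (if k = i then m $ a $ l $ j else 0)))"

lemma sum_UNIV_Plus:
  "(\<Sum>k\<in>(UNIV :: ('b::finite + 'c::finite) set). f k) = (\<Sum>k\<in>UNIV. f (Inl k)) + (\<Sum>k\<in>UNIV. f (Inr k))"
  using sum.Plus[of UNIV UNIV f] by (simp add: o_def)

lemma sum_UNIV_prod:
  "(\<Sum>k\<in>(UNIV :: ('b::finite \<times> 'c::finite) set). f k) = (\<Sum>i\<in>UNIV. \<Sum>j\<in>UNIV. f (i, j))"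
  by (simp add: sum.cartesian_product)

lemma End_matrix_ker:
  "End_matrix m *v x = 0 \<longleftrightarrow> pair_of_vec x \<in> End_rep (rep m)"
proof -
  have "(End_matrix m *v x) $ (a, i, j) =
      (snd (pair_of_vec x) ** m $ a - m $ a ** fst (pair_of_vec x)) $ i $ j" for a i j
  proof -
    have 1: "(\<Sum>k\<in>UNIV. \<Sum>l\<in>UNIV. (if l = j then - (m $ a $ i $ k) else 0) * x $ Inl (k, l)) =
        - (\<Sum>k\<in>UNIV. m $ a $ i $ k * x $ Inl (k, j))"
      by (simp add: if_distrib[of "\<lambda>z. z * _"] cong: if_cong) (simp add: sum_negf)
    \<comment> \<open>The sums are swapped so that the inner one runs over the index of the
      Kronecker delta.\<close>
    have "(\<Sum>k\<in>UNIV. \<Sum>l\<in>UNIV. (if k = i then m $ a $ l $ j else 0) * x $ Inr (k, l)) =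
        (\<Sum>l\<in>UNIV. \<Sum>k\<in>UNIV. (if k = i then m $ a $ l $ j * x $ Inr (k, l) else 0))"
      by (subst sum.swap) (auto intro!: sum.cong)
    also have "\<dots> = (\<Sum>l\<in>UNIV. m $ a $ l $ j * x $ Inr (i, l))"
      by simp
    finally show ?thesis
      using 1
      by (simp add: matrix_vector_mult_def End_matrix_def sum_UNIV_Plus sum_UNIV_prod pair_of_vec_def
          matrix_matrix_mult_def mult.commute)
  qed
  then have "End_matrix m *v x = 0 \<longleftrightarrow>
      (\<forall>a i j. (snd (pair_of_vec x) ** m $ a - m $ a ** fst (pair_of_vec x)) $ i $ j = 0)"
    by (simp add: vec_eq_iff[of "End_matrix m *v x"] split_paired_all)
  also have "\<dots> \<longleftrightarrow> pair_of_vec x \<in> End_rep (rep m)"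
    by (subst surjective_pairing[of "pair_of_vec x"], subst End_rep_iff) (simp add: vec_eq_iff)
  finally show ?thesis .
qed

lemma dim_End_rep: "mat_pair.dim (End_rep (rep m)) = vec.dim {x. End_matrix m *v x = 0}"
proof -
  have "pair_of_vec ` {x. End_matrix m *v x = 0} = pair_of_vec ` (pair_of_vec -` End_rep (rep m))"
    by (simp add: End_matrix_ker vimage_def)
  also have "\<dots> = End_rep (rep m)"
    by (rule surj_image_vimage_eq) (rule bij_is_surj[OF bij_pair_of_vec])
  finally have "pair_of_vec ` {x. End_matrix m *v x = 0} = End_rep (rep m)" .
  moreover have "mat_pair.dim (pair_of_vec ` {x. End_matrix m *v x = 0}) = vec.dim {x. End_matrix m *v x = 0}"
    by (rule pvfd.dim_image_eq[OF linear_pair_of_vec])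
      (rule inj_on_subset[OF bij_is_inj[OF bij_pair_of_vec] subset_UNIV])
  ultimately show ?thesis by simp
qed

text \<open>
  Choose $S$ and $\pi$ with $S\,T(0) + \pi = 1$ and $\pi$ a projection onto $\ker T(0)$. For all but
  finitely many $t$ the matrix $S\,T(t) + \pi$ is invertible, and then $\pi$ is injective on
  $\ker T(t)$.
\<close>
lemma dim_ker_semicontinuous:
  fixes T :: "'a::field \<Rightarrow> 'a^'n^'m"
  assumes "\<And>i j. is_poly (\<lambda>t. T t $ i $ j)"
  shows "finite {t. vec.dim {x. T t *v x = 0} > vec.dim {x. T 0 *v x = 0}}"
proof -
  let ?K = "\<lambda>t. {x. T t *v x = 0}"
  obtain B where B: "B \<subseteq> ?K 0" "vec.independent B" "?K 0 \<subseteq> vec.span B"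
    using vec.maximal_independent_subset by blast
  \<comment> \<open>The span of \<open>C - B\<close> is a complement of the kernel of
    \<open>T 0\<close>: \<pi> will kill it, and \<open>S\<close> will invert \<open>T 0\<close> on
    its image.\<close>
  obtain C where C: "B \<subseteq> C" "vec.independent C" "vec.span C = UNIV"
    using vec.maximal_independent_subset_extend[OF subset_UNIV B(2)] by (metis top.extremum_uniqueI)
  have lT: "Vector_Spaces.linear (*s) (*s) ((*v) (T 0))"
    by (rule matrix_vector_mul_linear_gen)
  obtain \<pi> :: "'a^'n \<Rightarrow> 'a^'n" where lin\<pi>: "Vector_Spaces.linear (*s) (*s) \<pi>"
    and \<pi>: "\<And>c. c \<in> C \<Longrightarrow> \<pi> c = (if c \<in> B then c else 0)"
    using vec.linear_independent_extend[OF C(2), of "\<lambda>c. if c \<in> B then c else 0"] by blast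
  have \<pi>B: "\<pi> x = x" if "x \<in> vec.span B" for x
    using vec.linear_eq_on[OF lin\<pi> vec.linear_id that] \<pi> C(1) by (simp add: subset_iff)
  have \<pi>0: "\<pi> x = 0" if "x \<in> vec.span (C - B)" for x
    using vec.linear_eq_on[OF lin\<pi> vec.linear_zero that] \<pi> by auto
  have inj: "inj_on ((*v) (T 0)) (vec.span (C - B))"
  proof (rule vec.linear_inj_on_iff_eq_0[THEN iffD2, OF lT vec.subspace_span], intro ballI impI)
    fix x assume x: "x \<in> vec.span (C - B)" "T 0 *v x = 0"
    then have "x \<in> vec.span B" using B(3) by auto
    then show "x = 0" using \<pi>B \<pi>0 x(1) by metis
  qed
  obtain S where linS: "Vector_Spaces.linear (*s) (*s) S"
    and S: "\<And>x. x \<in> vec.span (C - B) \<Longrightarrow> S (T 0 *v x) = x"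
    using vec.linear_exists_left_inverse_on[OF lT vec.subspace_span inj] by blast
  define R where "R t = matrix S ** T t + matrix \<pi>" for t
  have mS: "matrix S *v y = S y" and m\<pi>: "matrix \<pi> *v x = \<pi> x" for x y
    using matrix_works linS lin\<pi> by blast+
  have Rv: "R t *v x = S (T t *v x) + \<pi> x" for t x
    by (simp add: R_def matrix_vector_mult_add_rdistrib mS m\<pi> flip: matrix_vector_mul_assoc)
  have "R 0 *v x = x" for x
  proof (rule vec.linear_eq_on[of "(*v) (R 0)" "\<lambda>x. x" x C])
    fix c assume "c \<in> C"
    show "R 0 *v c = c"
    proof (cases "c \<in> B")
      case True
      then have "T 0 *v c = 0" using B(1) by auto
      then show ?thesis
        using True \<pi>[OF \<open>c \<in> C\<close>] vec.linear_0[OF linS] by (simp add: Rv)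
    next
      case False
      then have "c \<in> vec.span (C - B)"
        using \<open>c \<in> C\<close> by (simp add: vec.span_base)
      then show ?thesis
        by (simp add: Rv S \<pi>0)
    qed
  qed (use C(3) vec.linear_id in \<open>auto simp: id_def\<close>)
  then have "R 0 = mat 1"
    by (simp add: matrix_eq)
  then have "det (R 0) \<noteq> 0" by simp
  moreover have "is_poly (\<lambda>t. det (R t))"
    unfolding R_def
    by (rule is_poly_det) (auto intro!: is_poly_add is_poly_matrix_mult is_poly_const assms)
  ultimately have fin: "finite {t. det (R t) = 0}"
    using finite_zeros_is_poly by blast
  have "vec.dim (?K t) \<le> vec.dim (?K 0)" if "det (R t) \<noteq> 0" for t
  proof -
    have "inj ((*v) (R t))"
      using that inj_matrix_vector_mult invertible_det_nz by blast
    then have "vec.dim (?K t) = vec.dim ((*v) (R t) ` ?K t)"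
      by (intro vec.dim_image_eq[symmetric]) (auto intro: inj_on_subset)
    also have "\<dots> \<le> vec.dim (?K 0)"
    proof (rule vec.dim_mono)
      \<comment> \<open>On the kernel of \<open>T t\<close> the matrix \<open>R t\<close> acts as
        \<pi>, so its values there lie in the kernel of \<open>T 0\<close>.\<close>
      have "\<pi> x \<in> vec.span B" for x
      proof -
        have "\<pi> x \<in> \<pi> ` vec.span C" using C(3) by auto
        also have "\<dots> = vec.span (\<pi> ` C)"
          using vec.linear_span_image[OF lin\<pi>] by simp
        also have "\<dots> \<subseteq> vec.span B"
          by (rule vec.span_minimal) (auto simp: \<pi> vec.span_base vec.span_zero)
        finally show ?thesis .
      qed
      moreover have "vec.span B \<subseteq> vec.span (?K 0)"
        using B(1) by (rule vec.span_mono)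
      ultimately show "(*v) (R t) ` ?K t \<subseteq> vec.span (?K 0)"
        using vec.linear_0[OF linS] by (auto simp: Rv)
    qed
    finally show ?thesis .
  qed
  then have "{t. vec.dim (?K t) > vec.dim (?K 0)} \<subseteq> {t. det (R t) = 0}"
    by (auto simp: not_le[symmetric])
  then show ?thesis
    using fin finite_subset by blast
qed

text \<open>Each entry of \<open>End_matrix (\<gamma> t)\<close> is 0 or, up to sign, a coordinate
  of the curve, so semicontinuity of the kernel dimension applies.\<close>

lemma dim_End_semicontinuous:
  assumes "poly_curve \<gamma>" "mat_pair.dim (End_rep (rep (\<gamma> 0))) \<le> j"
  shows "finite {t. \<not> mat_pair.dim (End_rep (rep (\<gamma> t))) \<le> j}"
proof (rule finite_subset)
  show "{t. \<not> mat_pair.dim (End_rep (rep (\<gamma> t))) \<le> j} \<subseteq> {t. vec.dim {x. End_matrix (\<gamma> t) *v x = 0} >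
      vec.dim {x. End_matrix (\<gamma> 0) *v x = 0}}"
    using assms(2) by (auto simp: dim_End_rep)
  have "is_poly (\<lambda>t. End_matrix (\<gamma> t) $ r $ k)" for r k
  proof -
    have 1: "is_poly (\<lambda>t. \<gamma> t $ a $ i $ j)" for a i j
      using assms(1) by (simp add: poly_curve_def)
    have "is_poly (\<lambda>t. - (\<gamma> t $ a $ i $ j))" for a i j
      using is_poly_diff[OF is_poly_const[of 0] 1[of a i j]] by simp
    with 1 show ?thesis
      by (cases r; cases k) (auto simp: End_matrix_def intro!: is_poly_if is_poly_const)
  qed
  then show "finite {t. vec.dim {x. End_matrix (\<gamma> t) *v x = 0} >
      vec.dim {x. End_matrix (\<gamma> 0) *v x = 0}}"
    by (rule dim_ker_semicontinuous)
qed

section \<open>Idempotents and indecomposability\<close>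

text \<open>The component in \<open>V\<close> of a vector is unique; this uniqueness makes the map
  \<open>f\<close> picking it linear.\<close>

lemma projection_exists:
  fixes V V' :: "('a::field^'n) set"
  assumes V: "vec.subspace V" and V': "vec.subspace V'" and "direct_decomposition V V'"
  obtains A :: "'a^'n^'n" where "A ** A = A" "\<And>v. v \<in> V \<Longrightarrow> A *v v = v" "\<And>v. v \<in> V' \<Longrightarrow> A *v v = 0"
proof -
  have int: "V \<inter> V' = {0}" and sum: "\<And>x. \<exists>v v'. x = v + v' \<and> v \<in> V \<and> v' \<in> V'"
    using assms(3) unfolding direct_decomposition_def by blast+
  have "\<exists>v. v \<in> V \<and> x - v \<in> V'" for x
    using sum[of x] by force
  then obtain f where f: "f x \<in> V" "x - f x \<in> V'" for x
    by metis
  have uniq: "f x = v" if "v \<in> V" "x - v \<in> V'" for x v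
  proof -
    have "f x - v \<in> V"
      using f that V vec.subspace_diff by blast
    moreover have "(x - v) - (x - f x) \<in> V'"
      using f that V' vec.subspace_diff by blast
    moreover have "(x - v) - (x - f x) = f x - v"
      by simp
    ultimately have "f x - v \<in> V \<inter> V'"
      by (metis IntI)
    then show ?thesis
      by (simp only: int singleton_iff right_minus_eq)
  qed
  have lin: "Vector_Spaces.linear (*s) (*s) f"
  proof (unfold_locales)
    show "f (x + y) = f x + f y" for x y
      using vec.subspace_add[OF V f(1) f(1)] vec.subspace_add[OF V' f(2)[of x] f(2)[of y]]
      by (intro uniq) (auto simp: algebra_simps)
    show "f (c *s x) = c *s f x" for c x
      using vec.subspace_scale[OF V f(1)] vec.subspace_scale[OF V' f(2)[of x], of c]
      by (intro uniq) (auto simp: vector_ssub_ldistrib)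
  qed
  have A: "matrix f *v x = f x" for x
    by (rule matrix_works[OF lin])
  show thesis
  proof
    show *: "matrix f *v v = v" if "v \<in> V" for v
      using uniq[OF that] vec.subspace_0[OF V'] A by simp
    have "matrix f *v x \<in> V" for x
      using A f(1) by simp
    then show "matrix f ** matrix f = matrix f"
      using * by (simp add: matrix_eq flip: matrix_vector_mul_assoc)
    show "matrix f *v v = 0" if "v \<in> V'" for v
      using uniq[OF vec.subspace_0[OF V]] that A by simp
  qed
qed

lemma subspace_ker: "vec.subspace {x. (A :: 'a::field^'n^'m) *v x = 0}"
  by (auto simp: vec.subspace_def matrix_vector_right_distrib vec.scale)

lemma subspace_range: "vec.subspace (range ((*v) (A :: 'a::field^'n^'m)))"
  by (rule vec.linear_subspace_image[OF matrix_vector_mul_linear_gen vec.subspace_UNIV])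

lemma direct_decomposition_idempotent:
  assumes "A ** A = (A :: 'a::field^'n^'n)"
  shows "direct_decomposition (range ((*v) A)) {x. A *v x = 0}"
  unfolding direct_decomposition_def
proof (intro conjI)
  have *: "A *v (A *v x) = A *v x" for x
    using assms by (simp add: matrix_vector_mul_assoc)
  show "range ((*v) A) \<inter> {x. A *v x = 0} = {0}"
  proof (intro equalityI subsetI)
    fix x assume "x \<in> range ((*v) A) \<inter> {x. A *v x = 0}"
    then show "x \<in> {0}" using * by auto
  next
    fix x :: "'a^'n" assume "x \<in> {0}"
    then show "x \<in> range ((*v) A) \<inter> {x. A *v x = 0}"
      by (auto intro!: range_eqI[of _ _ 0])
  qed
  have "\<exists>v v'. x = v + v' \<and> v \<in> range ((*v) A) \<and> v' \<in> {x. A *v x = 0}" for x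
    using * by (intro exI[of _ "A *v x"] exI[of _ "x - A *v x"])
      (auto simp: matrix_vector_mult_diff_distrib)
  then show "{v + v' |v v'. v \<in> range ((*v) A) \<and> v' \<in> {x. A *v x = 0}} = UNIV"
    by auto
qed

lemma range_0_imp_0: "range ((*v) C) = {0} \<Longrightarrow> C = (0 :: 'a::field^'n^'n)"
  by (auto simp: matrix_eq)

lemma idempotent_ker_0:
  assumes "{x. C *v x = 0} = {0}" "C ** C = (C :: 'a::field^'n^'n)"
  shows "C = mat 1"
proof -
  have "C *v (x - C *v x) = 0" for x
    using assms(2) by (simp add: matrix_vector_mult_diff_distrib matrix_vector_mul_assoc)
  then have "x - C *v x = 0" for x
    using assms(1) by blast
  then show ?thesis
    by (simp add: matrix_eq)
qed

text \<open>An idempotent endomorphism splits the representation into its range and its kernel;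
  conversely a decomposition yields the pair of projections onto its first summand.\<close>

lemma indecomposable_iff_idempotents:
  fixes m :: "'a::field^'n^'m^'r"
  shows "indecomposable_rep (rep m) \<longleftrightarrow>
    (\<forall>A B. (A, B) \<in> End_rep (rep m) \<and> A ** A = A \<and> B ** B = B \<longrightarrow>
      (A = 0 \<and> B = 0) \<or> (A = mat 1 \<and> B = mat 1))"
proof (intro iffI allI impI)
  fix A B assume ind: "indecomposable_rep (rep m)"
    and "(A, B) \<in> End_rep (rep m) \<and> A ** A = A \<and> B ** B = B"
  then have comm: "\<And>a. B ** m $ a = m $ a ** A" and idem: "A ** A = A" "B ** B = B"
    by (auto simp: End_rep_iff)
  have comm': "B *v (m $ a *v x) = m $ a *v (A *v x)" for a x
    using comm[of a] by (simp add: matrix_vector_mul_assoc)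
  have "subrep (rep m) (range ((*v) A)) (range ((*v) B))"
    unfolding subrep_def rep_def
    using subspace_range[of A] subspace_range[of B] by (auto simp flip: comm')
  moreover have "subrep (rep m) {x. A *v x = 0} {x. B *v x = 0}"
    unfolding subrep_def rep_def 
    using comm' subspace_ker[of A] subspace_ker[of B] by auto
  ultimately have "(range ((*v) A) = {0} \<and> range ((*v) B) = {0}) \<or>
      ({x. A *v x = 0} = {0} \<and> {x. B *v x = 0} = {0})"
    using ind direct_decomposition_idempotent[OF idem(1)] direct_decomposition_idempotent[OF idem(2)]
    unfolding indecomposable_rep_def by (elim allE impE) (intro conjI)
  then show "(A = 0 \<and> B = 0) \<or> (A = mat 1 \<and> B = mat 1)"
    using range_0_imp_0[of A] range_0_imp_0[of B]
      idempotent_ker_0[OF _ idem(1)] idempotent_ker_0[OF _ idem(2)] by argo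
next
  assume idem: "\<forall>A B. (A, B) \<in> End_rep (rep m) \<and> A ** A = A \<and> B ** B = B \<longrightarrow>
      (A = 0 \<and> B = 0) \<or> (A = mat 1 \<and> B = mat 1)"
  show "indecomposable_rep (rep m)"
    unfolding indecomposable_rep_def
  proof (intro allI impI)
    fix V W V' W'
    assume "subrep (rep m) V W \<and> subrep (rep m) V' W' \<and>
        direct_decomposition V V' \<and> direct_decomposition W W'"
    then have sub: "vec.subspace V" "vec.subspace W" "vec.subspace V'" "vec.subspace W'"
      and inv: "\<And>a x. x \<in> V \<Longrightarrow> m $ a *v x \<in> W" "\<And>a x. x \<in> V' \<Longrightarrow> m $ a *v x \<in> W'"
      and dV: "direct_decomposition V V'" and dW: "direct_decomposition W W'"
      by (simp_all add: subrep_def rep_def image_subset_iff)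
    obtain A where A: "A ** A = A" "\<And>v. v \<in> V \<Longrightarrow> A *v v = v" "\<And>v. v \<in> V' \<Longrightarrow> A *v v = 0"
      using projection_exists[OF sub(1,3) dV] by metis
    obtain B where B: "B ** B = B" "\<And>v. v \<in> W \<Longrightarrow> B *v v = v" "\<And>v. v \<in> W' \<Longrightarrow> B *v v = 0"
      using projection_exists[OF sub(2,4) dW] by metis
    \<comment> \<open>The projections commute with the arrows because every arrow respects both
      summands.\<close>
    have "B *v (m $ a *v x) = m $ a *v (A *v x)" for a x
    proof -
      obtain v v' where "x = v + v'" "v \<in> V" "v' \<in> V'"
        using dV unfolding direct_decomposition_def by blast
      then show ?thesis
        using inv A B by (simp add: matrix_vector_right_distrib)
    qed
    then have "(A, B) \<in> End_rep (rep m)"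
      by (simp add: End_rep_def rep_def)
    then consider "A = 0" "B = 0" | "A = mat 1" "B = mat 1"
      using idem[rule_format, of A B] A(1) B(1) by argo
    then show "(V = {0} \<and> W = {0}) \<or> (V' = {0} \<and> W' = {0})"
    proof cases
      case 1
      then show ?thesis
        using A(2) B(2) sub[THEN vec.subspace_0] by fastforce
    next
      case 2
      then show ?thesis
        using A(3) B(3) sub[THEN vec.subspace_0] by fastforce
    qed
  qed
qed

section \<open>Change of bases\<close>

text \<open>\<open>P\<close> acts without inversion, so moving \<open>Q\<close>, \<open>P\<close>
  and \<open>m\<close> along lines gives a curve with polynomial coordinates.\<close>

definition act :: "'a::field^'m^'m \<Rightarrow> 'a^'n^'n \<Rightarrow> 'a^'n^'m^'r \<Rightarrow> 'a^'n^'m^'r" where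
  "act Q P m = (\<chi> a. Q ** m $ a ** P)"

lemma act_act: "act Q P (act Q' P' m) = act (Q ** Q') (P' ** P) m"
  by (simp add: act_def matrix_mul_assoc)

lemma act_1: "act (mat 1) (mat 1) m = m"
  by (simp add: act_def vec_eq_iff)

lemma matrix_mul_cancel:
  fixes X Y :: "'a::field^'n^'n"
  assumes "X ** Y = mat 1"
  shows "Z ** X ** Y = Z" "X ** (Y ** W) = W"
  using assms by (simp_all add: matrix_mul_assoc[symmetric]) (simp add: matrix_mul_assoc)

lemma End_rep_act:
  assumes Q: "Q ** Q' = mat 1" "Q' ** Q = mat 1" and P: "P ** P' = mat 1" "P' ** P = mat 1"
  shows "(A, B) \<in> End_rep (rep (act Q P m)) \<longleftrightarrow> (P ** A ** P', Q' ** B ** Q) \<in> End_rep (rep m)"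
proof -
  have "B ** (Q ** M ** P) = (Q ** M ** P) ** A \<longleftrightarrow> (Q' ** B ** Q) ** M = M ** (P ** A ** P')" for M
  proof
    assume "B ** (Q ** M ** P) = (Q ** M ** P) ** A"
    then have "Q' ** (B ** (Q ** M ** P)) ** P' = Q' ** ((Q ** M ** P) ** A) ** P'"
      by simp
    then show "(Q' ** B ** Q) ** M = M ** (P ** A ** P')"
      by (simp add: matrix_mul_assoc matrix_mul_cancel Q P)
  next
    assume "(Q' ** B ** Q) ** M = M ** (P ** A ** P')"
    then have "Q ** ((Q' ** B ** Q) ** M) ** P = Q ** (M ** (P ** A ** P')) ** P"
      by simp
    then show "B ** (Q ** M ** P) = (Q ** M ** P) ** A"
      by (simp add: matrix_mul_assoc matrix_mul_cancel Q P)
  qed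
  then show ?thesis
    by (simp add: End_rep_iff act_def)
qed

interpretation ppfd: finite_dimensional_vector_space_pair
  "scale_pair :: 'a::field \<Rightarrow> ('a^'n^'n) \<times> ('a^'m^'m) \<Rightarrow> _"
  "pair_of_vec ` (cart_basis :: ('a^(('n::finite \<times> 'n) + ('m::finite \<times> 'm))) set)"
  "scale_pair :: 'a \<Rightarrow> ('a^'n^'n) \<times> ('a^'m^'m) \<Rightarrow> _"
  "pair_of_vec ` (cart_basis :: ('a^(('n::finite \<times> 'n) + ('m::finite \<times> 'm))) set)"
  by unfold_locales

lemma scale_pair_eq: "scale_pair c p = (mat c ** fst p, mat c ** snd p)"
  by (simp add: scale_pair_def prod_eq_iff vec_eq_iff matrix_matrix_mult_def mat_def
      if_distrib[of "\<lambda>z. z * _"] cong: if_cong)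

lemma mat_mul_commute: "A ** mat c = mat c ** (A :: 'a::field^'n^'n)"
  by (simp add: vec_eq_iff matrix_matrix_mult_def mat_def if_distrib[of "\<lambda>z. z * _"]
      if_distrib[of "(*) _"] mult.commute cong: if_cong)

lemma matrix_add_rdistrib: "(B + C) ** A = B ** A + C ** (A :: 'a::semiring_1^'n^'k)"
  by (simp add: vec_eq_iff matrix_matrix_mult_def sum.distrib distrib_right)

text \<open>Conjugation at both vertices is a linear bijection between the two endomorphism
  spaces.\<close>

lemma dim_End_act:
  assumes "invertible Q" "invertible P"
  shows "mat_pair.dim (End_rep (rep (act Q P m))) = mat_pair.dim (End_rep (rep m))"
proof -
  obtain Q' P' where Q: "Q ** Q' = mat 1" "Q' ** Q = mat 1" and P: "P ** P' = mat 1" "P' ** P = mat 1"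
    using assms unfolding invertible_def by blast
  let ?T = "\<lambda>p. (P ** fst p ** P', Q' ** snd p ** Q)"
  have "Vector_Spaces.linear scale_pair scale_pair ?T"
    by unfold_locales (simp_all add: scale_pair_eq matrix_add_ldistrib matrix_add_rdistrib
        matrix_mul_assoc mat_mul_commute)
  moreover have inj: "inj ?T"
  proof (rule inj_on_inverseI[of _ "\<lambda>p. (P' ** fst p ** P, Q ** snd p ** Q')"])
    show "(P' ** fst (?T p) ** P, Q ** snd (?T p) ** Q') = p" for p
      by (simp add: matrix_mul_assoc matrix_mul_cancel Q P)
  qed
  moreover have "?T ` End_rep (rep (act Q P m)) = End_rep (rep m)"
  proof (intro equalityI subsetI)
    fix p assume "p \<in> ?T ` End_rep (rep (act Q P m))"
    then show "p \<in> End_rep (rep m)"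
      by (auto simp: End_rep_act[OF Q P])
  next
    fix p assume p: "p \<in> End_rep (rep m)"
    let ?q = "(P' ** fst p ** P, Q ** snd p ** Q')"
    have "?T ?q = p"
      by (simp add: matrix_mul_assoc matrix_mul_cancel Q P)
    moreover have "?q \<in> End_rep (rep (act Q P m))"
      unfolding End_rep_act[OF Q P] using p by (simp add: matrix_mul_assoc matrix_mul_cancel Q P)
    ultimately show "p \<in> ?T ` End_rep (rep (act Q P m))"
      by (intro image_eqI[of _ _ ?q]) simp_all
  qed
  ultimately show ?thesis
    using ppfd.dim_image_eq[of ?T "End_rep (rep (act Q P m))"] inj_on_subset[OF inj subset_UNIV] by simp
qed

lemma conj_idempotent:
  assumes "C' ** C = mat 1" "X ** X = (X :: 'a::field^'n^'n)"
  shows "(C ** X ** C') ** (C ** X ** C') = C ** X ** C'"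
proof -
  have "(C ** X ** C') ** (C ** X ** C') = C ** X ** (C' ** C) ** X ** C'"
    by (simp add: matrix_mul_assoc)
  also have "\<dots> = C ** (X ** X) ** C'"
    by (simp add: assms(1) matrix_mul_assoc)
  finally show ?thesis by (simp add: assms(2))
qed

lemma conj_eq_iff:
  assumes "C ** C' = mat 1" "C' ** C = mat (1 :: 'a::field)"
  shows "C ** X ** C' = Y \<longleftrightarrow> X = C' ** Y ** (C :: 'a^'n^'n)"
  by (auto simp: matrix_mul_assoc matrix_mul_cancel assms)

text \<open>Conjugation preserves idempotents and fixes 0 and 1, so the idempotent criterion
  transfers.\<close>

lemma indecomposable_act:
  fixes m :: "'a::field^'n^'m^'r"
  assumes "invertible Q" "invertible P" and ind: "indecomposable_rep (rep m)"
  shows "indecomposable_rep (rep (act Q P m))"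
proof -
  obtain Q' P' where Q: "Q ** Q' = mat 1" "Q' ** Q = mat 1" and P: "P ** P' = mat 1" "P' ** P = mat 1"
    using assms unfolding invertible_def by blast
  show ?thesis
    unfolding indecomposable_iff_idempotents
  proof (intro allI impI)
    fix A B assume *: "(A, B) \<in> End_rep (rep (act Q P m)) \<and> A ** A = A \<and> B ** B = B"
    have "(P ** A ** P', Q' ** B ** Q) \<in> End_rep (rep m)"
      using * End_rep_act[OF Q P] by blast
    moreover have "(P ** A ** P') ** (P ** A ** P') = P ** A ** P'"
      using * P conj_idempotent by blast
    moreover have "(Q' ** B ** Q) ** (Q' ** B ** Q) = Q' ** B ** Q"
      using * Q conj_idempotent by blast
    ultimately have "(P ** A ** P' = 0 \<and> Q' ** B ** Q = 0) \<or> (P ** A ** P' = mat 1 \<and> Q' ** B ** Q = mat 1)"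
      using ind unfolding indecomposable_iff_idempotents by blast
    then show "(A = 0 \<and> B = 0) \<or> (A = mat 1 \<and> B = mat 1)"
      by (simp add: conj_eq_iff[OF P] conj_eq_iff[OF Q(2,1)] P Q)
  qed
qed

lemma act_inverse:
  assumes "invertible Q" "invertible P"
  obtains Q' P' where "invertible Q'" "invertible P'" "\<And>m. act Q' P' (act Q P m) = m"
    "\<And>m. act Q P (act Q' P' m) = m"
proof -
  obtain Q' P' where Q: "Q ** Q' = mat 1" "Q' ** Q = mat 1" and P: "P ** P' = mat 1" "P' ** P = mat 1"
    using assms unfolding invertible_def by blast
  then show thesis
    by (intro that[of Q' P']) (auto simp: invertible_def act_act act_1)
qed

section \<open>Three by three matrices\<close>

text \<open>Explicit entries let simplification turn a matrix equation into nine scalar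
  equations.\<close>

definition mat33 :: "'a::field \<Rightarrow> 'a \<Rightarrow> 'a \<Rightarrow> 'a \<Rightarrow> 'a \<Rightarrow> 'a \<Rightarrow> 'a \<Rightarrow> 'a \<Rightarrow> 'a \<Rightarrow> 'a^3^3" where
  "mat33 a b c d e f g h i = vector [vector [a, b, c], vector [d, e, f], vector [g, h, i]]"

lemma mat33_nth [simp]:
  "mat33 a b c d e f g h i $ 1 $ 1 = a" "mat33 a b c d e f g h i $ 1 $ 2 = b"
  "mat33 a b c d e f g h i $ 1 $ 3 = c" "mat33 a b c d e f g h i $ 2 $ 1 = d"
  "mat33 a b c d e f g h i $ 2 $ 2 = e" "mat33 a b c d e f g h i $ 2 $ 3 = f"
  "mat33 a b c d e f g h i $ 3 $ 1 = g" "mat33 a b c d e f g h i $ 3 $ 2 = h"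
  "mat33 a b c d e f g h i $ 3 $ 3 = i"
  by (simp_all add: mat33_def)

lemma mat33_eq [simp]:
  "mat33 a b c d e f g h i = mat33 a' b' c' d' e' f' g' h' i' \<longleftrightarrow>
    a = a' \<and> b = b' \<and> c = c' \<and> d = d' \<and> e = e' \<and> f = f' \<and> g = g' \<and> h = h' \<and> i = i'"
  by (auto simp: vec_eq_iff forall_3)

lemma mat33_mult [simp]:
  "mat33 a b c d e f g h i ** mat33 a' b' c' d' e' f' g' h' i' =
    mat33 (a * a' + b * d' + c * g') (a * b' + b * e' + c * h') (a * c' + b * f' + c * i')
      (d * a' + e * d' + f * g') (d * b' + e * e' + f * h') (d * c' + e * f' + f * i')
      (g * a' + h * d' + i * g') (g * b' + h * e' + i * h') (g * c' + h * f' + i * i')"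
  by (simp add: vec_eq_iff forall_3 matrix_matrix_mult_def sum_3)

lemma mat33_add [simp]:
  "mat33 a b c d e f g h i + mat33 a' b' c' d' e' f' g' h' i' =
    mat33 (a + a') (b + b') (c + c') (d + d') (e + e') (f + f') (g + g') (h + h') (i + i')"
  by (simp add: vec_eq_iff forall_3)

lemma mat33_diff [simp]:
  "mat33 a b c d e f g h i - mat33 a' b' c' d' e' f' g' h' i' =
    mat33 (a - a') (b - b') (c - c') (d - d') (e - e') (f - f') (g - g') (h - h') (i - i')"
  by (simp add: vec_eq_iff forall_3)

lemma mat_mat33: "mat c = mat33 c 0 0 0 c 0 0 0 c"
  by (simp add: vec_eq_iff forall_3 mat_def)

lemma zero_mat33: "0 = mat33 0 0 0 0 0 0 0 0 0"
  by (simp add: vec_eq_iff forall_3)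

lemma mat33_exhaust:
  obtains a b c d e f g h i where "A = mat33 a b c d e f g h i"
proof
  show "A = mat33 (A$1$1) (A$1$2) (A$1$3) (A$2$1) (A$2$2) (A$2$3) (A$3$1) (A$3$2) (A$3$3)"
    by (simp add: vec_eq_iff forall_3)
qed

text \<open>For a basis u, v, w and \<open>P = cols u v w\<close>, the equation
  \<open>A ** P = P ** N\<close> says that \<open>N\<close> is the matrix of \<open>A\<close> in
  this basis.\<close>

definition cols :: "'a::field^3 \<Rightarrow> 'a^3 \<Rightarrow> 'a^3 \<Rightarrow> 'a^3^3" where
  "cols u v w = (\<chi> i. vector [u $ i, v $ i, w $ i])"

lemma cols_mult_vec: "cols u v w *v x = x $ 1 *s u + x $ 2 *s v + x $ 3 *s w"
  by (simp add: cols_def vec_eq_iff forall_3 matrix_vector_mult_def sum_3 mult.commute)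

lemma mult_cols: "A ** cols u v w = cols (A *v u) (A *v v) (A *v w)"
  by (simp add: cols_def vec_eq_iff forall_3 matrix_vector_mult_def matrix_matrix_mult_def sum_3)

lemma cols_mult_mat33:
  "cols u v w ** mat33 a b c d e f g h i =
    cols (a *s u + d *s v + g *s w) (b *s u + e *s v + h *s w) (c *s u + f *s v + i *s w)"
  by (simp add: cols_def vec_eq_iff forall_3 matrix_matrix_mult_def sum_3 mult.commute)

lemma invertibleI_ker: "(\<And>x. A *v x = 0 \<Longrightarrow> x = 0) \<Longrightarrow> invertible (A :: 'a::field^'n^'n)"
  by (simp add: invertible_left_inverse matrix_left_invertible_ker)

lemma invertible_colsI:
  assumes "\<And>a b c. a *s u + b *s v + c *s w = 0 \<Longrightarrow> a = 0 \<and> b = 0 \<and> c = 0"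
  shows "invertible (cols u v w)"
proof (rule invertibleI_ker)
  fix x assume "cols u v w *v x = 0"
  then have "x $ 1 = 0 \<and> x $ 2 = 0 \<and> x $ 3 = 0"
    by (intro assms) (simp add: cols_mult_vec)
  then show "x = 0"
    by (simp add: vec_eq_iff forall_3)
qed

lemma invertible_solve:
  fixes A :: "'a::field^'n^'n"
  assumes "invertible A"
  obtains x where "A *v x = y"
proof -
  obtain A' where "A ** A' = mat 1"
    using assms unfolding invertible_def by auto
  then have "A *v (A' *v y) = y"
    by (simp add: matrix_vector_mul_assoc)
  then show thesis by (rule that)
qed

lemma nonzero_mult_vec: "A \<noteq> 0 \<Longrightarrow> \<exists>v. A *v v \<noteq> (0 :: 'a::field^'m)" for A :: "'a::field^'n^'m"
  by (auto simp: matrix_eq)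

section \<open>Normal forms of nilpotent 3x3 matrices\<close>

lemma independent_Jordan_chain:
  assumes "A *v (A *v (A *v v)) = 0" "A *v (A *v v) \<noteq> (0 :: 'a::field^3)"
  shows "invertible (cols (A *v (A *v v)) (A *v v) v)"
proof (rule invertible_colsI)
  fix a b c assume eq: "a *s (A *v (A *v v)) + b *s (A *v v) + c *s v = 0"
  \<comment> \<open>Applying \<open>A\<close> twice to the relation isolates \<open>c\<close>;
    applying it once then isolates \<open>b\<close>.\<close>
  have "A *v (A *v (a *s (A *v (A *v v)) + b *s (A *v v) + c *s v)) = 0"
    by (simp add: eq)
  then have "c = 0"
    using assms by (simp add: matrix_vector_right_distrib vec.scale)
  have "A *v (a *s (A *v (A *v v)) + b *s (A *v v) + c *s v) = 0"
    by (simp add: eq)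
  then have "b = 0"
    using assms \<open>c = 0\<close> by (simp add: matrix_vector_right_distrib vec.scale)
  show "a = 0 \<and> b = 0 \<and> c = 0"
    using eq assms \<open>b = 0\<close> \<open>c = 0\<close> by simp
qed

definition J3 :: "'a::field^3^3" where "J3 = mat33 0 1 0 0 0 1 0 0 0"

text \<open>This matrix is also the square of \<open>J3\<close>.\<close>

definition E13 :: "'a::field^3^3" where "E13 = mat33 0 0 1 0 0 0 0 0 0"

lemma nilpotent_Jordan_form:
  fixes A :: "'a::field^3^3"
  assumes "A ** A ** A = 0" "A ** A \<noteq> 0"
  obtains P where "invertible P" "A ** P = P ** J3"
proof -
  obtain v where v: "A ** A *v v \<noteq> 0"
    using nonzero_mult_vec assms(2) by metis
  have 3: "A *v (A *v (A *v v)) = 0"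
    using assms(1) by (simp add: matrix_vector_mul_assoc matrix_mul_assoc)
  show thesis
  proof
    show "invertible (cols (A *v (A *v v)) (A *v v) v)"
      by (rule independent_Jordan_chain[OF 3]) (use v in \<open>simp add: matrix_vector_mul_assoc\<close>)
    show "A ** cols (A *v (A *v v)) (A *v v) v = cols (A *v (A *v v)) (A *v v) v ** J3"
      by (simp add: mult_cols J3_def cols_mult_mat33 3)
  qed
qed

text \<open>In dimension three a nonzero square-zero matrix has rank one. The adapted basis consists
  of Av, a second kernel vector, and a vector v with Av nonzero.\<close>

lemma square_zero_form:
  fixes A :: "'a::field^3^3"
  assumes "A ** A = 0" "A \<noteq> 0"
  obtains P where "invertible P" "A ** P = P ** E13"
proof -
  obtain v where v: "A *v v \<noteq> 0"
    using nonzero_mult_vec assms(2) by metis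
  define u where "u = A *v v"
  have AA: "A *v (A *v x) = 0" for x
    using assms(1) by (simp add: matrix_vector_mul_assoc)
  have dim3: "vec.dim (UNIV :: ('a^3) set) = 3"
    by (simp add: card_cart_basis)
  have "vec.dim (vec.span {u, v}) \<le> card {u, v}"
    by (rule vec.dim_le_card) auto
  also have "\<dots> \<le> 2"
    by (simp add: card_insert_if)
  finally have dim2: "vec.dim (vec.span {u, v}) \<le> 2" .
  have "vec.span {u, v} \<noteq> UNIV"
  proof
    assume "vec.span {u, v} = UNIV"
    from dim2[unfolded this dim3] show False by simp
  qed
  then obtain y where y: "y \<notin> vec.span {u, v}"
    by auto
  have span: "a *s u + c *s v \<in> vec.span {u, v}" for a c
    by (intro vec.span_add vec.span_scale vec.span_base) auto
  have indep: "a = 0 \<and> b = 0 \<and> c = 0" if eq: "a *s u + b *s y + c *s v = 0" for a b c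
  proof -
    have "b = 0"
    proof (rule ccontr)
      assume "b \<noteq> 0"
      have "b *s y = (a *s u + b *s y + c *s v) - (a *s u + c *s v)"
        by simp
      then have "b *s y \<in> vec.span {u, v}"
        unfolding eq by (simp only: vec.span_diff[OF vec.span_zero span])
      then have "inverse b *s (b *s y) \<in> vec.span {u, v}"
        by (rule vec.span_scale)
      then show False
        using y \<open>b \<noteq> 0\<close> by (simp add: vector_smult_assoc)
    qed
    have "A *v (a *s u + b *s y + c *s v) = 0"
      by (simp add: eq)
    then have "c = 0"
      using \<open>b = 0\<close> v AA by (simp add: matrix_vector_right_distrib vec.scale u_def)
    show ?thesis
      using eq \<open>b = 0\<close> \<open>c = 0\<close> v by (simp add: u_def)
  qed
  then have "invertible (cols u y v)"
    by (intro invertible_colsI) auto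
  then obtain x where "cols u y v *v x = A *v y"
    by (rule invertible_solve)
  then obtain a b c where Ay: "A *v y = a *s u + b *s y + c *s v"
    by (metis cols_mult_vec)
  \<comment> \<open>Expanding A(Ay) = 0 in the basis u, y, v forces b = c = 0. Then Ay = a u, and y
    - a v is the second kernel vector.\<close>
  have "0 = A *v (a *s u + b *s y + c *s v)"
    using AA[of y] Ay by simp
  also have "\<dots> = (b * a + c) *s u + (b * b) *s y + (b * c) *s v"
    by (simp add: matrix_vector_right_distrib vec.scale Ay AA u_def[symmetric] vector_sadd_rdistrib
        vector_smult_assoc vec.scale_right_distrib) (simp add: u_def AA)
  finally have "b * a + c = 0 \<and> b * b = 0 \<and> b * c = 0"
    using indep by metis
  then have "b = 0" "c = 0" by auto
  then have 0: "A *v (y - a *s v) = 0"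
    by (simp add: matrix_vector_mult_diff_distrib vec.scale Ay u_def)
  show thesis
  proof
    show "invertible (cols u (y - a *s v) v)"
    proof (rule invertible_colsI)
      fix r s t assume "r *s u + s *s (y - a *s v) + t *s v = 0"
      then have "r *s u + s *s y + (t - s * a) *s v = 0"
        by (simp add: algebra_simps vector_smult_assoc vector_ssub_ldistrib vector_sub_rdistrib)
      then show "r = 0 \<and> s = 0 \<and> t = 0"
        using indep[of r s "t - s * a"] by auto
    qed
    show "A ** cols u (y - a *s v) v = cols u (y - a *s v) v ** E13"
      by (simp add: mult_cols E13_def cols_mult_mat33 0) (simp add: u_def AA)
  qed
qed

section \<open>Endomorphisms of indecomposable representations\<close>

lemma eigenvector_exists:
  fixes A :: "'a::alg_closed_field^3^3"
  obtains c v where "v \<noteq> 0" "(A - mat c) *v v = 0"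
proof -
  obtain a b c d e f g h i where A: "A = mat33 a b c d e f g h i"
    by (rule mat33_exhaust)
  \<comment> \<open>This is det(A - t) as a polynomial in t; its leading coefficient -1 makes it
    nonconstant in every characteristic.\<close>
  define p where "p = [:a*e*i + b*f*g + c*d*h - c*e*g - b*d*i - a*f*h,
    b*d + c*g + f*h - a*e - a*i - e*i, a + e + i, -1:]"
  have "degree p > 0"
    by (simp add: p_def)
  then obtain t where "poly p t = 0"
    using alg_closed_imp_poly_has_root by auto
  moreover have "poly p t = det (A - mat t)"
    by (simp add: p_def A mat_mat33 det_3 algebra_simps)
  ultimately have "\<not> invertible (A - mat t)"
    by (simp add: invertible_det_nz)
  then show thesis
    using that invertibleI_ker by metis
qed

text \<open>In dimension three the kernels of the powers of \<open>A\<close> are stable from the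
  cube on, so the cube is injective on its own range.\<close>

lemma Fitting_decomposition:
  fixes A :: "'a::field^3^3"
  shows "direct_decomposition {x. A ** A ** A *v x = 0} (range ((*v) (A ** A ** A)))"
proof -
  define C where "C = A ** A ** A"
  have Cv: "C *v x = A *v (A *v (A *v x))" for x
    by (simp add: C_def matrix_vector_mul_assoc matrix_mul_assoc)
  \<comment> \<open>Otherwise A^3 y, A^2 y, A y would be a basis; expressing y in it and applying
    A^3 would give A^3 y = 0.\<close>
  have step: "A *v (A *v (A *v y)) = 0" if 4: "A *v (A *v (A *v (A *v y))) = 0" for y
  proof (rule ccontr)
    assume ne: "A *v (A *v (A *v y)) \<noteq> 0"
    obtain x where "cols (A *v (A *v (A *v y))) (A *v (A *v y)) (A *v y) *v x = y"
      using invertible_solve independent_Jordan_chain[OF 4 ne] by metis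
    then have "y = x $ 1 *s (A *v (A *v (A *v y))) + x $ 2 *s (A *v (A *v y)) + x $ 3 *s (A *v y)"
      by (simp add: cols_mult_vec)
    then have "A *v (A *v (A *v y)) = A *v (A *v (A *v
        (x $ 1 *s (A *v (A *v (A *v y))) + x $ 2 *s (A *v (A *v y)) + x $ 3 *s (A *v y))))"
      by simp
    also have "\<dots> = 0"
      by (simp add: matrix_vector_right_distrib vec.scale 4)
    finally show False using ne by simp
  qed
  then have CC: "C *v x = 0" if "C *v (C *v x) = 0" for x
    using that unfolding Cv by metis
  have lin: "Vector_Spaces.linear (*s) (*s) ((*v) C)"
    by (rule matrix_vector_mul_linear_gen)
  \<comment> \<open>Injectivity preserves the dimension of the range, so \<open>C\<close> maps its
    range onto itself. This writes every vector as a kernel vector plus a range vector.\<close>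
  have "inj_on ((*v) C) (range ((*v) C))"
    by (subst vec.linear_inj_on_iff_eq_0[OF lin subspace_range]) (auto dest: CC)
  moreover have "vec.span (range ((*v) C)) = range ((*v) C)"
    by (rule vec.span_eq_iff[THEN iffD2, OF subspace_range])
  ultimately have "vec.dim ((*v) C ` range ((*v) C)) = vec.dim (range ((*v) C))"
    by (intro vec.dim_image_eq[OF lin]) (simp only:)
  then have *: "(*v) C ` range ((*v) C) = range ((*v) C)"
    by (intro vec.subspace_dim_equal vec.linear_subspace_image[OF lin] subspace_range) auto
  have "\<exists>v v'. x = v + v' \<and> C *v v = 0 \<and> v' \<in> range ((*v) C)" for x
  proof -
    have "C *v x \<in> (*v) C ` range ((*v) C)"
      unfolding * by simp
    then obtain y where "C *v x = C *v (C *v y)"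
      by auto
    then show ?thesis
      by (intro exI[of _ "x - C *v y"] exI[of _ "C *v y"]) (simp add: matrix_vector_mult_diff_distrib)
  qed
  then have "{v + v' |v v'. v \<in> {x. C *v x = 0} \<and> v' \<in> range ((*v) C)} = UNIV"
    by auto
  moreover have "{x. C *v x = 0} \<inter> range ((*v) C) = {0}"
  proof (intro equalityI subsetI)
    fix x assume "x \<in> {x. C *v x = 0} \<inter> range ((*v) C)"
    then show "x \<in> {0}" using CC by auto
  next
    fix x :: "'a^3" assume "x \<in> {0}"
    then show "x \<in> {x. C *v x = 0} \<inter> range ((*v) C)"
      by (auto intro!: range_eqI[of _ _ 0])
  qed
  ultimately show ?thesis
    unfolding direct_decomposition_def C_def by simp
qed

lemma End_rep_scalar: "(mat c, mat c) \<in> End_rep (rep m)"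
  by (simp add: End_rep_iff vec_eq_iff matrix_matrix_mult_def mat_def if_distrib[of "\<lambda>z. z * _"]
      if_distrib[of "(*) _"] mult.commute cong: if_cong)

lemma End_rep_diff:
  "(A, B) \<in> End_rep (rep m) \<Longrightarrow> (A', B') \<in> End_rep (rep m) \<Longrightarrow> (A - A', B - B') \<in> End_rep (rep m)"
  using mat_pair.subspace_diff[OF subspace_End_rep, of "(A, B)" m "(A', B')"] by simp

lemma End_rep_add:
  "(A, B) \<in> End_rep (rep m) \<Longrightarrow> (A', B') \<in> End_rep (rep m) \<Longrightarrow> (A + A', B + B') \<in> End_rep (rep m)"
  using mat_pair.subspace_add[OF subspace_End_rep, of "(A, B)" m "(A', B')"] by simp

lemma End_rep_mult:
  "(A, B) \<in> End_rep (rep m) \<Longrightarrow> (A', B') \<in> End_rep (rep m) \<Longrightarrow> (A ** A', B ** B') \<in> End_rep (rep m)"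
  by (auto simp: End_rep_iff) (metis matrix_mul_assoc)

text \<open>Take an eigenvalue c of \<open>A\<close>. Fitting's decomposition at both vertices
  splits the representation, and the kernel part contains an eigenvector, so the range part is zero
  at both vertices. Hence the same c serves \<open>B\<close>.\<close>

lemma indecomposable_endo:
  fixes m :: "'a::alg_closed_field^3^3^'r"
  assumes ind: "indecomposable_rep (rep m)" and AB: "(A, B) \<in> End_rep (rep m)"
  obtains c where "(A - mat c) ** (A - mat c) ** (A - mat c) = 0"
    "(B - mat c) ** (B - mat c) ** (B - mat c) = 0"
proof -
  obtain c v where v: "v \<noteq> 0" "(A - mat c) *v v = 0"
    by (rule eigenvector_exists)
  define N where "N = (A - mat c) ** (A - mat c) ** (A - mat c)"
  define M where "M = (B - mat c) ** (B - mat c) ** (B - mat c)"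
  have "(N, M) \<in> End_rep (rep m)"
    unfolding N_def M_def by (intro End_rep_mult End_rep_diff AB End_rep_scalar)
  then have comm: "M *v (m $ a *v x) = m $ a *v (N *v x)" for a x
    by (simp add: End_rep_def rep_def)
  have "subrep (rep m) {x. N *v x = 0} {x. M *v x = 0}"
    unfolding subrep_def rep_def using comm subspace_ker[of N] subspace_ker[of M] by auto
  moreover have "subrep (rep m) (range ((*v) N)) (range ((*v) M))"
    unfolding subrep_def rep_def using subspace_range[of N] subspace_range[of M]
    by (auto simp flip: comm)
  moreover have "direct_decomposition {x. N *v x = 0} (range ((*v) N))"
    "direct_decomposition {x. M *v x = 0} (range ((*v) M))"
    unfolding N_def M_def by (rule Fitting_decomposition)+
  ultimately have "({x. N *v x = 0} = {0} \<and> {x. M *v x = 0} = {0}) \<or>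
      (range ((*v) N) = {0} \<and> range ((*v) M) = {0})"
    using ind unfolding indecomposable_rep_def by (elim allE impE) (intro conjI)
  moreover have "v \<in> {x. N *v x = 0}"
    using v(2) by (simp add: N_def flip: matrix_vector_mul_assoc)
  ultimately have "range ((*v) N) = {0}" "range ((*v) M) = {0}"
    using v(1) by auto
  then have "N = 0" "M = 0"
    by (simp_all add: range_0_imp_0)
  then show thesis
    using that by (simp add: N_def M_def)
qed

text \<open>All arrows kill the range of \<open>A\<close>, so a nonzero vector in it would span a
  direct summand concentrated at the source.\<close>

lemma indecomposable_End_right_0:
  fixes m :: "'a::field^'n^'m^'r"
  assumes ind: "indecomposable_rep (rep m)" and "(A, 0) \<in> End_rep (rep m)"
  shows "A = 0"
proof (rule ccontr)
  assume "A \<noteq> 0"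
  then obtain v where "A *v v \<noteq> 0"
    using nonzero_mult_vec by metis
  define u where "u = A *v v"
  obtain i where i: "u $ i \<noteq> 0"
    using \<open>A *v v \<noteq> 0\<close> by (auto simp: u_def vec_eq_iff)
  have mu: "m $ a *v u = 0" for a
  proof -
    have "m $ a ** A = 0"
      using assms(2) by (simp add: End_rep_iff vec_eq_iff matrix_matrix_mult_def)
    then show ?thesis
      by (simp add: u_def matrix_vector_mul_assoc)
  qed
  \<comment> \<open>This is the projection x \<mapsto> (x_i / u_i) u onto the line through
    \<open>u\<close>.\<close>
  define C where "C = (\<chi> k l. if l = i then u $ k / u $ i else 0)"
  have "C ** C = C"
    using i by (simp add: C_def vec_eq_iff matrix_matrix_mult_def if_distrib[of "\<lambda>z. z * _"]
        if_distrib[of "(*) _"] if_distrib[of "\<lambda>z. z / _"] cong: if_cong)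
  moreover have "(C, 0) \<in> End_rep (rep m)"
  proof -
    have "(m $ a ** C) $ k $ l = (if l = i then (m $ a *v u) $ k / u $ i else 0)" for a k l
      by (simp add: C_def matrix_matrix_mult_def matrix_vector_mult_def sum_divide_distrib)
    then have "m $ a ** C = 0" for a
      by (simp add: mu vec_eq_iff)
    then show ?thesis
      by (simp add: End_rep_iff vec_eq_iff matrix_matrix_mult_def)
  qed
  moreover have "(0::'a^'m^'m) \<noteq> mat 1"
    by (simp add: vec_eq_iff mat_def)
  moreover have "C \<noteq> 0"
    using i by (auto simp: C_def vec_eq_iff intro!: exI[of _ i])
  moreover have "(0::'a^'m^'m) ** 0 = 0"
    by (simp add: vec_eq_iff matrix_matrix_mult_def)
  ultimately show False
    using ind[unfolded indecomposable_iff_idempotents, rule_format, of C 0] by auto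
qed

text \<open>Dually, a nonzero row of \<open>B\<close> annihilates the images of all arrows, and a
  summand concentrated at the target splits off.\<close>

lemma indecomposable_End_left_0:
  fixes m :: "'a::field^'n^'m^'r"
  assumes ind: "indecomposable_rep (rep m)" and "(0, B) \<in> End_rep (rep m)"
  shows "B = 0"
proof (rule ccontr)
  assume "B \<noteq> 0"
  then obtain k j where kj: "B $ k $ j \<noteq> 0"
    by (auto simp: vec_eq_iff)
  define g where "g = B $ k"
  have gm: "(\<Sum>i\<in>UNIV. g $ i * m $ a $ i $ l) = 0" for a l
  proof -
    have "B ** m $ a = 0"
      using assms(2) by (simp add: End_rep_iff vec_eq_iff matrix_matrix_mult_def)
    then have "(B ** m $ a) $ k $ l = 0"
      by simp
    then show ?thesis
      by (simp add: g_def matrix_matrix_mult_def)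
  qed
  \<comment> \<open>A rank-one idempotent onto the j-th coordinate line whose kernel is the kernel
    of the linear form \<open>g\<close>.\<close>
  define C where "C = (\<chi> i l. if i = j then g $ l / g $ j else 0)"
  have "C ** C = C"
    using kj by (simp add: C_def g_def vec_eq_iff matrix_matrix_mult_def if_distrib[of "\<lambda>z. z * _"]
        if_distrib[of "(*) _"] if_distrib[of "\<lambda>z. z / _"] cong: if_cong)
  moreover have "(0, C) \<in> End_rep (rep m)"
  proof -
    have "(C ** m $ a) $ i $ l = (if i = j then (\<Sum>i\<in>UNIV. g $ i * m $ a $ i $ l) / g $ j else 0)"
      for a i l
      by (simp add: C_def matrix_matrix_mult_def sum_divide_distrib)
    then have "C ** m $ a = 0" for a
      by (simp add: gm vec_eq_iff)
    then show ?thesis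
      by (simp add: End_rep_iff vec_eq_iff matrix_matrix_mult_def)
  qed
  moreover have "(0::'a^'n^'n) \<noteq> mat 1"
    by (simp add: vec_eq_iff mat_def)
  moreover have "C \<noteq> 0"
    using kj by (auto simp: C_def g_def vec_eq_iff intro!: exI[of _ j])
  moreover have "(0::'a^'n^'n) ** 0 = 0"
    by (simp add: vec_eq_iff matrix_matrix_mult_def)
  ultimately show False
    using ind[unfolded indecomposable_iff_idempotents, rule_format, of 0 C] by auto
qed

section \<open>Orbits of commuting families\<close>

text \<open>This is the set H_N: the union of the base change orbits of all families commuting with
  \<open>N\<close>, not a single orbit.\<close>

definition orbit :: "'a::field^'n^'n \<Rightarrow> 'a^'n^'n^'r \<Rightarrow> bool" where
  "orbit N m \<longleftrightarrow> (\<exists>Q P m'. invertible Q \<and> invertible P \<and> m = act Q P m' \<and> (N, N) \<in> End_rep (rep m'))"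

definition affine_line :: "'a::field \<Rightarrow> 'a^'n^'m \<Rightarrow> 'a^'n^'m \<Rightarrow> 'a^'n^'m" where
  "affine_line t X Y = (\<chi> i j. X $ i $ j + t * (Y $ i $ j - X $ i $ j))"

lemma affine_line_0: "affine_line 0 X Y = X" and affine_line_1: "affine_line 1 X Y = Y"
  by (simp_all add: affine_line_def vec_eq_iff)

lemma is_poly_affine_line: "is_poly (\<lambda>t. affine_line t X Y $ i $ j)"
  by (simp add: affine_line_def is_poly_intros)

lemma matrix_mul_affine_line: "N ** affine_line t X Y = affine_line t (N ** X) (N ** Y)"
  by (simp add: affine_line_def matrix_matrix_mult_def vec_eq_iff sum.distrib sum_subtractf sum_distrib_left
      algebra_simps)

lemma affine_line_matrix_mul: "affine_line t X Y ** N = affine_line t (X ** N) (Y ** N)"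
  by (simp add: affine_line_def matrix_matrix_mult_def vec_eq_iff sum.distrib sum_subtractf sum_distrib_left
      algebra_simps)

text \<open>The two base changes and the commuting family are interpolated linearly. Commuting with
  \<open>N\<close> is a linear condition and persists; invertibility and the dimension bound hold at
  t = 0, hence for all but finitely many t.\<close>

lemma orbit_curve:
  fixes x y :: "'a::field^'n^'n^'r"
  assumes x: "orbit N x" "mat_pair.dim (End_rep (rep x)) \<le> j" and y: "orbit N y"
  shows "\<exists>\<gamma>. poly_curve \<gamma> \<and> \<gamma> 0 = x \<and> \<gamma> 1 = y \<and>
    finite {t. \<gamma> t \<notin> {m. orbit N m \<and> mat_pair.dim (End_rep (rep m)) \<le> j}}"
proof -
  obtain Q P x' where X: "invertible Q" "invertible P" "x = act Q P x'" "(N, N) \<in> End_rep (rep x')"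
    using x(1) unfolding orbit_def by auto
  obtain Q1 P1 y' where Y: "invertible Q1" "invertible P1" "y = act Q1 P1 y'" "(N, N) \<in> End_rep (rep y')"
    using y unfolding orbit_def by auto
  define L :: "'a \<Rightarrow> 'a^'n^'n^'r" where "L t = (\<chi> a. affine_line t (x' $ a) (y' $ a))" for t
  define \<gamma> where "\<gamma> t = act (affine_line t Q Q1) (affine_line t P P1) (L t)" for t
  have \<gamma>: "poly_curve \<gamma>"
    unfolding poly_curve_def \<gamma>_def act_def L_def
    by (simp add: is_poly_matrix_mult is_poly_affine_line)
  have \<gamma>0: "\<gamma> 0 = x" and \<gamma>1: "\<gamma> 1 = y"
    by (simp_all add: \<gamma>_def affine_line_0 affine_line_1 L_def X(3) Y(3) act_def)
  have NL: "(N, N) \<in> End_rep (rep (L t))" for t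
    using X(4) Y(4) by (simp add: End_rep_iff L_def matrix_mul_affine_line affine_line_matrix_mul)
  have fQ: "finite {t. det (affine_line t Q Q1) = 0}"
    using X(1) by (intro finite_zeros_is_poly[of _ 0] is_poly_det is_poly_affine_line)
      (simp add: affine_line_0 invertible_det_nz)
  have fP: "finite {t. det (affine_line t P P1) = 0}"
    using X(2) by (intro finite_zeros_is_poly[of _ 0] is_poly_det is_poly_affine_line)
      (simp add: affine_line_0 invertible_det_nz)
  have fD: "finite {t. \<not> mat_pair.dim (End_rep (rep (\<gamma> t))) \<le> j}"
    using dim_End_semicontinuous[OF \<gamma>] x(2) \<gamma>0 by simp
  have "orbit N (\<gamma> t)" if "det (affine_line t Q Q1) \<noteq> 0" "det (affine_line t P P1) \<noteq> 0" for t
    unfolding orbit_def \<gamma>_def using that NL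
    by (intro exI[of _ "affine_line t Q Q1"] exI[of _ "affine_line t P P1"] exI[of _ "L t"])
      (simp add: invertible_det_nz)
  then have "{t. \<gamma> t \<notin> {m. orbit N m \<and> mat_pair.dim (End_rep (rep m)) \<le> j}} \<subseteq>
      {t. det (affine_line t Q Q1) = 0} \<union> {t. det (affine_line t P P1) = 0} \<union>
      {t. \<not> mat_pair.dim (End_rep (rep (\<gamma> t))) \<le> j}"
    by auto
  moreover have "finite ({t. det (affine_line t Q Q1) = 0} \<union> {t. det (affine_line t P P1) = 0} \<union>
      {t. \<not> mat_pair.dim (End_rep (rep (\<gamma> t))) \<le> j})"
    using fQ fP fD by (intro finite_UnI)
  ultimately have "finite {t. \<gamma> t \<notin> {m. orbit N m \<and> mat_pair.dim (End_rep (rep m)) \<le> j}}"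
    by (rule finite_subset)
  then show ?thesis
    using \<gamma> \<gamma>0 \<gamma>1 by (intro exI[of _ \<gamma>] conjI)
qed

lemma act_U_Q3: "invertible Q \<Longrightarrow> invertible P \<Longrightarrow> m \<in> U_Q3 j \<Longrightarrow> act Q P m \<in> U_Q3 j"
  by (simp add: U_Q3_def dim_End_act indecomposable_act)

lemma orbit_act:
  assumes "invertible Q" "invertible P" "orbit N m"
  shows "orbit N (act Q P m)"
proof -
  obtain Q' P' m' where *: "invertible Q'" "invertible P'" "m = act Q' P' m'" "(N, N) \<in> End_rep (rep m')"
    using assms(3) unfolding orbit_def by auto
  then show ?thesis
    unfolding orbit_def
    by (intro exI[of _ "Q ** Q'"] exI[of _ "P' ** P"] exI[of _ m'])
      (simp add: invertible_mult assms act_act)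
qed

text \<open>Bases at the two vertices change independently, so it is enough that \<open>A\<close>
  and \<open>B\<close> are separately similar to \<open>N\<close>.\<close>

lemma conjugate_endo:
  assumes AB: "(A, B) \<in> End_rep (rep m)" and inv: "invertible P" "invertible Q"
    and A: "A ** P = P ** N" and B: "B ** Q = Q ** N"
  obtains Q' P' m' where "invertible Q'" "invertible P'" "m = act Q' P' m'"
    "(N, N) \<in> End_rep (rep m')"
proof -
  obtain Q' where Q: "Q ** Q' = mat 1" "Q' ** Q = mat 1"
    using inv(2) unfolding invertible_def by auto
  obtain P' where P: "P ** P' = mat 1" "P' ** P = mat 1"
    using inv(1) unfolding invertible_def by auto
  have "P ** N ** P' = A" "Q ** N ** Q' = B"
    using A B by (simp_all add: matrix_mul_cancel P Q flip: A B)
  then have "(N, N) \<in> End_rep (rep (act Q' P m))"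
    using AB by (simp add: End_rep_act[OF Q(2,1) P])
  moreover have "m = act Q P' (act Q' P m)"
    by (simp add: act_act act_1 P Q)
  moreover have "invertible P'"
    using P unfolding invertible_def by auto
  ultimately show thesis
    using that inv(2) by metis
qed

lemma orbit_E13:
  fixes m :: "'a::field^3^3^'r"
  assumes "(A, B) \<in> End_rep (rep m)" "A ** A = 0" "B ** B = 0" "A \<noteq> 0" "B \<noteq> 0"
  shows "orbit E13 m"
proof -
  obtain P where P: "invertible P" "A ** P = P ** E13"
    using square_zero_form[OF assms(2,4)] by metis
  obtain Q where Q: "invertible Q" "B ** Q = Q ** E13"
    using square_zero_form[OF assms(3,5)] by metis
  show ?thesis
    using conjugate_endo[OF assms(1) P(1) Q(1) P(2) Q(2)] unfolding orbit_def by metis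
qed

lemma orbit_J3:
  fixes m :: "'a::field^3^3^'r"
  assumes "(A, B) \<in> End_rep (rep m)" "A ** A ** A = 0" "B ** B ** B = 0" "A ** A \<noteq> 0" "B ** B \<noteq> 0"
  shows "orbit J3 m"
proof -
  obtain P where P: "invertible P" "A ** P = P ** J3"
    using nilpotent_Jordan_form[OF assms(2,4)] by metis
  obtain Q where Q: "invertible Q" "B ** Q = Q ** J3"
    using nilpotent_Jordan_form[OF assms(3,5)] by metis
  show ?thesis
    using conjugate_endo[OF assms(1) P(1) Q(1) P(2) Q(2)] unfolding orbit_def by metis
qed

lemma End_rep_commute:
  "(A, B) \<in> End_rep (rep m) \<Longrightarrow> B ** m $ a = m $ a ** A"
  by (simp add: End_rep_iff)

section \<open>Dimension estimates\<close>

lemma mat_pair_span3: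
  "p \<in> mat_pair.span {x, y, z} \<longleftrightarrow> (\<exists>a b c. p = scale_pair a x + scale_pair b y + scale_pair c z)"
proof
  assume "p \<in> mat_pair.span {x, y, z}"
  then obtain a b c where "p - scale_pair a x - scale_pair b y - scale_pair c z = 0"
    by (auto simp: mat_pair.span_insert)
  then have "p = scale_pair a x + scale_pair b y + scale_pair c z"
    by (simp add: algebra_simps)
  then show "\<exists>a b c. p = scale_pair a x + scale_pair b y + scale_pair c z"
    by auto
next
  assume "\<exists>a b c. p = scale_pair a x + scale_pair b y + scale_pair c z"
  then show "p \<in> mat_pair.span {x, y, z}"
    by (auto intro!: mat_pair.span_add mat_pair.span_scale intro: mat_pair.span_base)
qed

text \<open>The bound is a cardinality so that repeated generators give the bounds 1 and 2 as well.\<close>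
lemma dim_End_le3:
  fixes m :: "'a::field^'n^'m^'r"
  assumes "\<And>A B. (A, B) \<in> End_rep (rep m) \<Longrightarrow>
    \<exists>a b c. A = mat a ** A1 + mat b ** A2 + mat c ** A3 \<and> B = mat a ** B1 + mat b ** B2 + mat c ** B3"
  shows "mat_pair.dim (End_rep (rep m)) \<le> card {(A1, B1), (A2, B2), (A3, B3)}"
proof (rule mat_pair.dim_le_card)
  show "End_rep (rep m) \<subseteq> mat_pair.span {(A1, B1), (A2, B2), (A3, B3)}"
  proof
    fix p assume "p \<in> End_rep (rep m)"
    then show "p \<in> mat_pair.span {(A1, B1), (A2, B2), (A3, B3)}"
      using assms[of "fst p" "snd p"] by (simp add: mat_pair_span3 scale_pair_eq prod_eq_iff)
  qed
qed simp

text \<open>An independent set as large as the upper bound for the dimension is a basis.\<close>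

lemma End_spanned3:
  fixes m :: "'a::field^'n^'m^'r"
  assumes "S \<subseteq> End_rep (rep m)" "mat_pair.independent S" "mat_pair.dim (End_rep (rep m)) \<le> card S"
  shows "mat_pair.dim (End_rep (rep m)) = card S" "End_rep (rep m) \<subseteq> mat_pair.span S"
  using pfd.independent_card_le_dim[OF assms(1,2)] assms(3)
    pfd.card_ge_dim_independent[OF assms] by auto

section \<open>Indecomposability from nilpotency, and membership in \<open>U_Q3 j\<close>\<close>

lemma indecomposableI_nilpotent:
  fixes m :: "'a::field^3^3^'r"
  assumes "\<And>A B. (A, B) \<in> End_rep (rep m) \<Longrightarrow> \<exists>c. (A - mat c) ** (A - mat c) ** (A - mat c) = 0 \<and>
    (B - mat c) ** (B - mat c) ** (B - mat c) = 0"
  shows "indecomposable_rep (rep m)"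
  unfolding indecomposable_iff_idempotents
proof (intro allI impI)
  fix A B assume *: "(A, B) \<in> End_rep (rep m) \<and> A ** A = A \<and> B ** B = B"
  then obtain c where c: "(A - mat c) ** (A - mat c) ** (A - mat c) = 0"
    "(B - mat c) ** (B - mat c) ** (B - mat c) = 0"
    using assms by metis
  \<comment> \<open>C - c acts as 1 - c on the range of an idempotent \<open>C\<close> and as -c on
    its kernel. Nilpotency forces c = 1 unless the range is zero, and c = 0 unless the kernel is
    zero; the common c makes \<open>A\<close> and \<open>B\<close> both 0 or both 1.\<close>
  have eigen: "C *v v = 0 \<or> c = 1" "v = C *v v \<or> c = 0"
    if "C ** C = C" "(C - mat c) ** (C - mat c) ** (C - mat c) = 0" for C :: "'a^3^3" and v
  proof -
    have mat: "mat c *v w = c *s w" for w :: "'a^3"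
      by (simp add: vec_eq_iff matrix_vector_mult_def mat_def if_distrib[of "\<lambda>z. z * _"] cong: if_cong)
    have 3: "(C - mat c) *v ((C - mat c) *v ((C - mat c) *v w)) = 0" for w
      using that(2) by (simp add: matrix_vector_mul_assoc matrix_mul_assoc)
    have step: "(C - mat c) *v w = (1 - c) *s w" if "C *v w = w" for w
      using that by (simp add: matrix_vector_mult_diff_rdistrib mat vector_sub_rdistrib)
    have step0: "(C - mat c) *v w = (- c) *s w" if "C *v w = 0" for w
      using that by (simp add: matrix_vector_mult_diff_rdistrib mat)
    \<comment> \<open>The factor \<open>r\<close> keeps the vectors in a shape to which
      \<open>step\<close> and \<open>step0\<close> apply three times in a row.\<close>
    have C: "C *v (r *s (C *v v)) = r *s (C *v v)" "C *v (r *s (v - C *v v)) = 0" for r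
      using that(1) by (simp_all add: vec.scale matrix_vector_mult_diff_distrib matrix_vector_mul_assoc)
    show "C *v v = 0 \<or> c = 1"
      using 3[of "1 *s (C *v v)"] by (simp only: step C vector_smult_assoc) auto
    show "v = C *v v \<or> c = 0"
      using 3[of "1 *s (v - C *v v)"] by (simp only: step0 C vector_smult_assoc) auto
  qed
  show "(A = 0 \<and> B = 0) \<or> (A = mat 1 \<and> B = mat 1)"
  proof (cases "c = 1")
    case True
    then have "A *v v = v" "B *v v = v" for v
      using eigen(2)[of A v] eigen(2)[of B v] * c by auto
    then show ?thesis by (simp add: matrix_eq)
  next
    case False
    then have "A *v v = 0" "B *v v = 0" for v
      using eigen(1)[of A v] eigen(1)[of B v] * c by auto
    then show ?thesis by (simp add: matrix_eq)
  qed
qed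

lemma U_Q3_1I:
  fixes m :: "'a::field^3^3^3"
  assumes "mat_pair.dim (End_rep (rep m)) \<le> 1"
  shows "m \<in> U_Q3 1"
proof -
  let ?S = "{(mat 1, mat 1)} :: (('a^3^3) \<times> ('a^3^3)) set"
  have S: "?S \<subseteq> End_rep (rep m)"
    using End_rep_scalar by simp
  have ind: "mat_pair.independent ?S"
    by (simp add: mat_mat33 zero_prod_def zero_mat33)
  note span = End_spanned3[OF S ind]
  have "indecomposable_rep (rep m)"
  proof (rule indecomposableI_nilpotent)
    fix A B assume "(A, B) \<in> End_rep (rep m)"
    then have "(A, B) \<in> mat_pair.span ?S"
      using span(2) assms by auto
    then obtain c where "A = mat c" "B = mat c"
      by (auto simp: mat_pair.span_insert scale_pair_eq zero_prod_def)
    then show "\<exists>c. (A - mat c) ** (A - mat c) ** (A - mat c) = 0 \<and>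
        (B - mat c) ** (B - mat c) ** (B - mat c) = 0"
      by (intro exI[of _ c]) (simp add: mat_mat33 zero_mat33)
  qed
  then show ?thesis
    using span(1) assms by (simp add: U_Q3_def)
qed

text \<open>The identity and \<open>E13\<close> already fill up the bound, so every endomorphism is
  a scalar plus a multiple of a nilpotent one.\<close>

lemma U_Q3_2I:
  fixes m :: "'a::field^3^3^3"
  assumes E: "(E13, E13) \<in> End_rep (rep m)" and "mat_pair.dim (End_rep (rep m)) \<le> 2"
  shows "m \<in> U_Q3 2"
proof -
  let ?S = "{(mat 1, mat 1), (E13, E13)} :: (('a^3^3) \<times> ('a^3^3)) set"
  have S: "?S \<subseteq> End_rep (rep m)"
    using End_rep_scalar E by simp
  have ne: "(mat 1, mat 1) \<noteq> (E13 :: 'a^3^3, E13 :: 'a^3^3)"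
    by (simp add: mat_mat33 E13_def)
  then have card: "card ?S = 2" by simp
  have ind: "mat_pair.independent ?S"
    using ne by (simp add: mat_pair.independent_insert mat_pair.span_insert mat_mat33 zero_prod_def
        zero_mat33 scale_pair_eq E13_def)
  note span = End_spanned3[OF S ind]
  have "indecomposable_rep (rep m)"
  proof (rule indecomposableI_nilpotent)
    fix A B assume "(A, B) \<in> End_rep (rep m)"
    then have "(A, B) \<in> mat_pair.span ?S"
      using span(2) assms card by auto
    then obtain c b where "A - mat c - mat b ** E13 = 0" "B - mat c - mat b ** E13 = 0"
      by (auto simp: mat_pair.span_insert scale_pair_eq zero_prod_def)
    then have "A - mat c = mat b ** E13" "B - mat c = mat b ** E13"
      by simp_all
    then show "\<exists>c. (A - mat c) ** (A - mat c) ** (A - mat c) = 0 \<and>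
        (B - mat c) ** (B - mat c) ** (B - mat c) = 0"
      by (intro exI[of _ c]) (simp add: mat_mat33 zero_mat33 E13_def)
  qed
  then show ?thesis
    using span(1) assms card by (simp add: U_Q3_def)
qed

text \<open>The identity, \<open>J3\<close> and its square already fill up the bound, so every
  endomorphism is a polynomial in \<open>J3\<close>.\<close>

lemma U_Q3_3I:
  fixes m :: "'a::field^3^3^3"
  assumes J: "(J3, J3) \<in> End_rep (rep m)" and "mat_pair.dim (End_rep (rep m)) \<le> 3"
  shows "m \<in> U_Q3 3"
proof -
  let ?S = "{(mat 1, mat 1), (J3, J3), (J3 ** J3, J3 ** J3)} :: (('a^3^3) \<times> ('a^3^3)) set"
  have S: "?S \<subseteq> End_rep (rep m)"
    using End_rep_scalar J End_rep_mult[OF J J] by simp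
  have ne: "(mat 1, mat 1) \<noteq> (J3 :: 'a^3^3, J3 :: 'a^3^3)"
    "(mat 1, mat 1) \<noteq> (J3 ** J3 :: 'a^3^3, J3 ** J3 :: 'a^3^3)"
    "(J3, J3) \<noteq> (J3 ** J3 :: 'a^3^3, J3 ** J3 :: 'a^3^3)"
    by (simp_all add: mat_mat33 J3_def)
  then have card: "card ?S = 3" by simp
  have ind: "mat_pair.independent ?S"
    using ne by (simp add: mat_pair.independent_insert mat_pair.span_insert mat_mat33 zero_prod_def
        zero_mat33 scale_pair_eq J3_def)
  note span = End_spanned3[OF S ind]
  have "indecomposable_rep (rep m)"
  proof (rule indecomposableI_nilpotent)
    fix A B assume "(A, B) \<in> End_rep (rep m)"
    then have "(A, B) \<in> mat_pair.span ?S"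
      using span(2) assms card by auto
    then obtain c b d where "A - mat c - mat b ** J3 - mat d ** (J3 ** J3) = 0"
      "B - mat c - mat b ** J3 - mat d ** (J3 ** J3) = 0"
      by (auto simp: mat_pair.span_insert scale_pair_eq zero_prod_def)
    then have "A - mat c = mat b ** J3 + mat d ** (J3 ** J3)" "B - mat c = mat b ** J3 + mat d ** (J3 ** J3)"
      by (simp_all add: algebra_simps)
    then show "\<exists>c. (A - mat c) ** (A - mat c) ** (A - mat c) = 0 \<and>
        (B - mat c) ** (B - mat c) ** (B - mat c) = 0"
      by (intro exI[of _ c]) (simp add: mat_mat33 zero_mat33 J3_def)
  qed
  then show ?thesis
    using span(1) assms card by (simp add: U_Q3_def)
qed

lemma orbit_U_Q3:
  fixes m :: "'a::field^3^3^3"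
  assumes U: "\<And>m' :: 'a^3^3^3. (N, N) \<in> End_rep (rep m') \<Longrightarrow>
      mat_pair.dim (End_rep (rep m')) \<le> j \<Longrightarrow> m' \<in> U_Q3 j"
    and "orbit N m" "mat_pair.dim (End_rep (rep m)) \<le> j"
  shows "m \<in> U_Q3 j"
proof -
  obtain Q P m' where *: "invertible Q" "invertible P" "m = act Q P m'" "(N, N) \<in> End_rep (rep m')"
    using assms(2) unfolding orbit_def by auto
  then have "m' \<in> U_Q3 j"
    using assms(3) by (intro U) (simp_all add: dim_End_act)
  then show ?thesis
    using * by (simp add: act_U_Q3)
qed

section \<open>Structure of indecomposables with many endomorphisms\<close>

text \<open>Without nonzero square-zero endomorphisms there are no nonzero nilpotent ones: if N^3 =
  0, then N^2 squares to zero, so N^2 = 0 and then N = 0. A nonzero endomorphism is nonzero at both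
  vertices, as \<open>orbit_E13\<close> requires.\<close>

lemma dim_le_1_or_orbit_E13:
  fixes m :: "'a::alg_closed_field^3^3^'r"
  assumes ind: "indecomposable_rep (rep m)"
  shows "mat_pair.dim (End_rep (rep m)) \<le> 1 \<or> orbit E13 m"
proof (rule disjCI)
  assume not: "\<not> orbit E13 m"
  have "\<exists>c. A = mat c \<and> B = mat c" if AB: "(A, B) \<in> End_rep (rep m)" for A B
  proof -
    obtain c where c: "(A - mat c) ** (A - mat c) ** (A - mat c) = 0"
      "(B - mat c) ** (B - mat c) ** (B - mat c) = 0"
      using indecomposable_endo[OF ind AB] by metis
    define N M where "N = A - mat c" and "M = B - mat c"
    have NM: "(N, M) \<in> End_rep (rep m)"
      unfolding N_def M_def by (intro End_rep_diff AB End_rep_scalar)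
    have zero: "X = 0 \<longleftrightarrow> Y = 0" if "(X, Y) \<in> End_rep (rep m)" for X Y
      using that indecomposable_End_left_0[OF ind, of Y] indecomposable_End_right_0[OF ind, of X] by auto
    have sq0: "X = 0 \<and> Y = 0" if "(X, Y) \<in> End_rep (rep m)" "X ** X = 0" "Y ** Y = 0" for X Y
      using orbit_E13[OF that] not zero[OF that(1)] by auto
    have "(N ** N) ** (N ** N) = (N ** N ** N) ** N" "(M ** M) ** (M ** M) = (M ** M ** M) ** M"
      by (simp_all add: matrix_mul_assoc)
    then have "(N ** N) ** (N ** N) = 0" "(M ** M) ** (M ** M) = 0"
      using c by (simp_all add: N_def M_def)
    then have "N ** N = 0 \<and> M ** M = 0"
      using sq0[OF End_rep_mult[OF NM NM]] by simp
    then have "N = 0 \<and> M = 0"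
      using sq0[OF NM] by simp
    then show ?thesis
      by (auto simp: N_def M_def)
  qed
  then have "mat_pair.dim (End_rep (rep m)) \<le>
      card {(mat 1 :: 'a^3^3, mat 1 :: 'a^3^3), (mat 1, mat 1), (mat 1, mat 1)}"
    by (intro dim_End_le3) (metis add.right_neutral mat_0 matrix_mul_rid mat_mul_commute)
  then show "mat_pair.dim (End_rep (rep m)) \<le> 1" by simp
qed

text \<open>The arrows are upper triangular Toeplitz matrices, and the identity arrow forces A = B.
  Some arrow has a nonzero superdiagonal, and only polynomials in \<open>J3\<close> commute with
  it.\<close>

lemma dim_End_le3_Toeplitz_unit:
  fixes m :: "'a::field^3^3^'r"
  assumes ind: "indecomposable_rep (rep m)" and J: "(J3, J3) \<in> End_rep (rep m)"
    and unit: "m $ a0 = mat 1"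
  shows "mat_pair.dim (End_rep (rep m)) \<le> 3"
proof -
  have "\<exists>c p q. m $ a = mat33 c p q 0 c p 0 0 c" for a
  proof -
    obtain x1 x2 x3 x4 x5 x6 x7 x8 x9 where "m $ a = mat33 x1 x2 x3 x4 x5 x6 x7 x8 x9"
      by (rule mat33_exhaust)
    then show ?thesis
      using End_rep_commute[OF J, of a] by (simp add: J3_def)
  qed
  then obtain c p q where m: "m $ a = mat33 (c a) (p a) (q a) 0 (c a) (p a) 0 0 (c a)" for a
    by metis
  \<comment> \<open>Otherwise the projection onto the middle coordinate would be an idempotent
    endomorphism.\<close>
  have "\<exists>a. p a \<noteq> 0"
  proof (rule ccontr)
    assume "\<not> ?thesis"
    then have "(mat33 0 0 0 0 1 0 0 0 0, mat33 0 0 0 0 1 0 0 0 0) \<in> End_rep (rep m)"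
      by (simp add: End_rep_iff m)
    then show False
      using ind unfolding indecomposable_iff_idempotents
      by (auto simp: zero_mat33 mat_mat33 dest!: spec[of _ "mat33 0 0 0 0 1 0 0 0 0"])
  qed
  then obtain b where b: "p b \<noteq> 0" by auto
  have "\<exists>r s t. A = mat r ** mat 1 + mat s ** J3 + mat t ** (J3 ** J3) \<and>
      B = mat r ** mat 1 + mat s ** J3 + mat t ** (J3 ** J3)" if AB: "(A, B) \<in> End_rep (rep m)" for A B
  proof -
    have "B = A"
      using End_rep_commute[OF AB, of a0] by (simp add: unit)
    obtain x1 x2 x3 x4 x5 x6 x7 x8 x9 where A: "A = mat33 x1 x2 x3 x4 x5 x6 x7 x8 x9"
      by (rule mat33_exhaust)
    have "x7 = 0 \<and> x4 = 0 \<and> x8 = 0 \<and> x5 = x1 \<and> x9 = x1 \<and> x6 = x2"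
      using End_rep_commute[OF AB, of b] b by (auto simp: \<open>B = A\<close> A m algebra_simps)
    then show ?thesis
      by - (rule exI[of _ x1], rule exI[of _ x2], rule exI[of _ x3],
        simp add: \<open>B = A\<close> A J3_def mat_mat33)
  qed
  then have "mat_pair.dim (End_rep (rep m)) \<le>
      card {(mat 1 :: 'a^3^3, mat 1 :: 'a^3^3), (J3, J3), (J3 ** J3, J3 ** J3)}"
    by (rule dim_End_le3)
  also have "\<dots> \<le> 3"
    by (simp add: card_insert_if)
  finally show ?thesis .
qed

text \<open>Some arrow has a nonzero diagonal and is invertible; multiplying by its inverse reduces
  to the case of an identity arrow.\<close>

lemma dim_End_le3_orbit_J3:
  fixes m :: "'a::field^3^3^'r"
  assumes ind: "indecomposable_rep (rep m)" and "orbit J3 m"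
  shows "mat_pair.dim (End_rep (rep m)) \<le> 3"
proof -
  obtain Q P m' where *: "invertible Q" "invertible P" "m = act Q P m'" and J: "(J3, J3) \<in> End_rep (rep m')"
    using assms(2) unfolding orbit_def by auto
  obtain Q' P' where "invertible Q'" "invertible P'" "act Q' P' m = m'"
    using act_inverse[OF *(1,2)] *(3) by metis
  then have ind': "indecomposable_rep (rep m')"
    using indecomposable_act ind by metis
  have "\<exists>c p q. m' $ a = mat33 c p q 0 c p 0 0 c" for a
  proof -
    obtain x1 x2 x3 x4 x5 x6 x7 x8 x9 where "m' $ a = mat33 x1 x2 x3 x4 x5 x6 x7 x8 x9"
      by (rule mat33_exhaust)
    then show ?thesis
      using End_rep_commute[OF J, of a] by (simp add: J3_def)
  qed
  then obtain c p q where m: "m' $ a = mat33 (c a) (p a) (q a) 0 (c a) (p a) 0 0 (c a)" for a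
    by metis
  \<comment> \<open>Otherwise every arrow would kill the first basis vector at the source.\<close>
  have "\<exists>a. c a \<noteq> 0"
  proof (rule ccontr)
    assume "\<not> ?thesis"
    then have "(mat33 1 0 0 0 0 0 0 0 0, 0) \<in> End_rep (rep m')"
      by (simp add: End_rep_iff m zero_mat33)
    then show False
      using indecomposable_End_right_0[OF ind'] by (force simp: zero_mat33)
  qed
  then obtain a where a: "c a \<noteq> 0" by auto
  have "invertible (m' $ a)"
    using a by (simp add: invertible_det_nz m det_3)
  then obtain X where X: "m' $ a ** X = mat 1" "X ** m' $ a = mat 1"
    unfolding invertible_def by auto
  then have "invertible X"
    unfolding invertible_def by auto
  have inv1: "invertible (mat 1 :: 'a^3^3)"
    by (simp add: invertible_det_nz)
  have "(J3, J3) \<in> End_rep (rep (act X (mat 1) m'))"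
  proof (subst End_rep_act[OF X(2,1), of "mat 1" "mat 1"])
    have "m' $ a ** J3 ** X = J3 ** m' $ a ** X"
      using End_rep_commute[OF J, of a] by simp
    also have "\<dots> = J3"
      by (simp add: matrix_mul_cancel X)
    finally show "(mat 1 ** J3 ** mat 1, m' $ a ** J3 ** X) \<in> End_rep (rep m')"
      using J by simp
  qed simp_all
  moreover have "act X (mat 1) m' $ a = mat 1"
    by (simp add: act_def X)
  ultimately have "mat_pair.dim (End_rep (rep (act X (mat 1) m'))) \<le> 3"
    by (intro dim_End_le3_Toeplitz_unit indecomposable_act \<open>invertible X\<close> inv1 ind')
  then show ?thesis
    using * by (simp add: dim_End_act \<open>invertible X\<close> inv1)
qed

text \<open>Used when all nilpotent endomorphisms square to zero: then so does the sum of
  \<open>E13\<close> and another one, after subtracting its eigenvalue c. This forces c = 0 and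
  makes \<open>A\<close> strictly upper triangular.\<close>

lemma square_zero_pair_form:
  fixes A :: "'a::field^3^3"
  assumes A: "A ** A = 0" and EA: "(E13 + A - mat c) ** (E13 + A - mat c) = 0"
  obtains x y z where "A = mat33 0 x y 0 0 z 0 0 0" "x * z = 0"
proof -
  obtain x1 x2 x3 x4 x5 x6 x7 x8 x9 where A_eq: "A = mat33 x1 x2 x3 x4 x5 x6 x7 x8 x9"
    by (rule mat33_exhaust)
  note e = A[unfolded A_eq zero_mat33, simplified]
  \<comment> \<open>Subtracting A^2 = 0 leaves equations linear in the entries of
    \<open>A\<close>.\<close>
  have "(E13 + A - mat c) ** (E13 + A - mat c) - A ** A = 0"
    using A EA by simp
  note f = this[unfolded A_eq zero_mat33 E13_def mat_mat33, simplified]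
  have "c = 0"
  proof (rule ccontr)
    assume "c \<noteq> 0"
    \<comment> \<open>The middle diagonal entry gives c = 2 x5, so a nonzero c already excludes
      characteristic 2; A^2 = 0 then gives x5 = 0.\<close>
    have "c * (c - 2 * x5) = 0"
      using f by algebra
    then have c: "c = 2 * x5"
      using \<open>c \<noteq> 0\<close> by simp
    have "2 * c * x4 = 0" "2 * c * x8 = 0"
      using f by algebra+
    moreover have "(2 :: 'a) \<noteq> 0"
      using \<open>c \<noteq> 0\<close> c by auto
    ultimately have "x4 = 0" "x8 = 0"
      using \<open>c \<noteq> 0\<close> by simp_all
    then have "x5 * x5 = 0"
      using e by simp
    then show False
      using \<open>c \<noteq> 0\<close> c by simp
  qed
  then have 1: "x7 = 0" "x8 = 0" "x4 = 0"
    using f by (simp_all add: algebra_simps)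
  then have 2: "x1 = 0" "x5 = 0" "x9 = 0"
    using e by simp_all
  then have "x2 * x6 = 0"
    using e 1 by simp
  then show thesis
    using that 1 2 A_eq by simp
qed

lemma orbit_J3_upper:
  fixes m :: "'a::field^3^3^'r"
  assumes "(mat33 0 x y 0 0 z 0 0 0, mat33 0 x' y' 0 0 z' 0 0 0) \<in> End_rep (rep m)"
    "x \<noteq> 0" "z \<noteq> 0" "x' \<noteq> 0" "z' \<noteq> 0"
  shows "orbit J3 m"
  by (rule orbit_J3[OF assms(1)]) (use assms(2-) in \<open>simp_all add: zero_mat33\<close>)

lemma mat33_curve:
  fixes f :: "'r::finite \<Rightarrow> 'a::field \<Rightarrow> 'a^3^3"
  assumes "\<And>a i j. is_poly (\<lambda>t. f a t $ i $ j)"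
  shows "poly_curve (\<lambda>t. (\<chi> a. f a t))"
  using assms by (simp add: poly_curve_def)

lemma is_poly_mat33:
  assumes "is_poly a" "is_poly b" "is_poly c" "is_poly d" "is_poly e" "is_poly f" "is_poly g" "is_poly h"
    "is_poly k"
  shows "is_poly (\<lambda>t. mat33 (a t) (b t) (c t) (d t) (e t) (f t) (g t) (h t) (k t) $ i $ j)"
proof -
  have "\<forall>i j. is_poly (\<lambda>t. mat33 (a t) (b t) (c t) (d t) (e t) (f t) (g t) (h t) (k t) $ i $ j)"
    using assms by (simp add: forall_3)
  then show ?thesis by simp
qed

text \<open>
  In each of the three cases \<open>m\<close> is perturbed in one entry, chosen so that the given square-zero
  endomorphism deforms to one whose square is nonzero at both vertices.
\<close>
lemma degeneration_of_orbit_J3: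
  fixes m :: "'a::field^3^3^'r"
  assumes ind: "indecomposable_rep (rep m)"
    and m: "\<And>a. m $ a = mat33 (c a) (p a) (q a) 0 (d a) (r a) 0 0 (c a)" and a0: "c a0 \<noteq> 0"
    and psi: "(mat33 0 x y 0 0 z 0 0 0, mat33 0 x' y' 0 0 z' 0 0 0) \<in> End_rep (rep m)"
    and xz: "x * z = 0" and ne: "x \<noteq> 0 \<or> z \<noteq> 0"
  shows "\<exists>\<gamma>. poly_curve \<gamma> \<and> \<gamma> 0 = m \<and> (\<forall>t. t \<noteq> 0 \<longrightarrow> orbit J3 (\<gamma> t))"
proof -
  \<comment> \<open>These are the entries (1,2), (1,3) and (2,3) of the commutation
    relation.\<close>
  have eqs: "c a * x = x' * d a" "c a * y + p a * z = x' * r a + y' * c a" "d a * z = z' * c a" for a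
    using End_rep_commute[OF psi, of a] by (simp_all add: m)
  consider (1) "x \<noteq> 0" "z = 0" | (2) "x = 0" "z \<noteq> 0" "x' \<noteq> 0" | (3) "x = 0" "z \<noteq> 0" "x' = 0"
    using xz ne by auto
  then show ?thesis
  proof cases
    case 1
    have "x' \<noteq> 0"
      using eqs(1)[of a0] a0 1 by auto
    \<comment> \<open>With t p added at (2,3), the endomorphism may acquire (2,3) entries
      \<open>x' * t\<close> and \<open>x * t\<close>: the relation at (1,3) stays balanced, and the
      one at (2,3) follows from c x = x' d.\<close>
    define \<gamma> :: "'a \<Rightarrow> 'a^3^3^'r" where
      "\<gamma> t = (\<chi> a. mat33 (c a) (p a) (q a) 0 (d a) (r a + t * p a) 0 0 (c a))" for t
    have "poly_curve \<gamma>"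
      unfolding \<gamma>_def by (intro mat33_curve is_poly_mat33 is_poly_intros)
    moreover have "\<gamma> 0 = m"
      by (simp add: \<gamma>_def vec_eq_iff[of _ m] m)
    moreover have "orbit J3 (\<gamma> t)" if "t \<noteq> 0" for t
    proof (rule orbit_J3_upper)
      show "(mat33 0 x y 0 0 (x' * t) 0 0 0, mat33 0 x' y' 0 0 (x * t) 0 0 0) \<in> End_rep (rep (\<gamma> t))"
        using eqs 1 by (simp add: End_rep_iff \<gamma>_def) (simp add: algebra_simps)
    qed (use 1 \<open>x' \<noteq> 0\<close> that in simp_all)
    ultimately show ?thesis by auto
  next
    case 2
    have "d a = 0" for a
      using eqs(1)[of a] 2 by simp
    then have "z' = 0"
      using eqs(3)[of a0] a0 by simp
    \<comment> \<open>The vanishing middle diagonal becomes t c, so entries \<open>x' * t\<close> at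
      the source and \<open>z * t\<close> at the target become admissible; the relation at (1,3) is
      unchanged.\<close>
    define \<gamma> :: "'a \<Rightarrow> 'a^3^3^'r" where
      "\<gamma> t = (\<chi> a. mat33 (c a) (p a) (q a) 0 (t * c a) (r a) 0 0 (c a))" for t
    have "poly_curve \<gamma>"
      unfolding \<gamma>_def by (intro mat33_curve is_poly_mat33 is_poly_intros)
    moreover have "\<gamma> 0 = m"
      by (simp add: \<gamma>_def vec_eq_iff[of _ m] m \<open>\<And>a. d a = 0\<close>)
    moreover have "orbit J3 (\<gamma> t)" if "t \<noteq> 0" for t
    proof (rule orbit_J3_upper)
      show "(mat33 0 (x' * t) y 0 0 z 0 0 0, mat33 0 x' y' 0 0 (z * t) 0 0 0) \<in> End_rep (rep (\<gamma> t))"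
        using eqs(2) by (simp add: End_rep_iff \<gamma>_def)
    qed (use 2 that in simp_all)
    ultimately show ?thesis by auto
  next
    case 3
    \<comment> \<open>If z' = 0, subtracting a multiple of \<open>E13\<close> would leave a nonzero
      endomorphism vanishing at the target.\<close>
    have "z' \<noteq> 0"
    proof
      assume "z' = 0"
      have "(E13, E13) \<in> End_rep (rep m)"
        by (simp add: End_rep_iff m E13_def)
      then have "(mat y' ** E13, mat y' ** E13) \<in> End_rep (rep m)"
        by (intro End_rep_mult End_rep_scalar)
      from End_rep_diff[OF psi this]
      have "(mat33 0 0 (y - y') 0 0 z 0 0 0, 0) \<in> End_rep (rep m)"
        using 3 \<open>z' = 0\<close> by (simp add: mat_mat33 E13_def zero_mat33)
      then show False
        using indecomposable_End_right_0[OF ind] 3 by (force simp: zero_mat33)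
    qed
    \<comment> \<open>With t r added at (1,2), the new (1,2) entries \<open>t * z'\<close> and
      \<open>t * z\<close> are compatible because d z = z' c.\<close>
    define \<gamma> :: "'a \<Rightarrow> 'a^3^3^'r" where
      "\<gamma> t = (\<chi> a. mat33 (c a) (p a + t * r a) (q a) 0 (d a) (r a) 0 0 (c a))" for t
    have "poly_curve \<gamma>"
      unfolding \<gamma>_def by (intro mat33_curve is_poly_mat33 is_poly_intros)
    moreover have "\<gamma> 0 = m"
      by (simp add: \<gamma>_def vec_eq_iff[of _ m] m)
    moreover have "orbit J3 (\<gamma> t)" if "t \<noteq> 0" for t
    proof (rule orbit_J3_upper)
      show "(mat33 0 (t * z') y 0 0 z 0 0 0, mat33 0 (t * z) y' 0 0 z' 0 0 0) \<in> End_rep (rep (\<gamma> t))"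
        using eqs(2,3) 3 by (simp add: End_rep_iff \<gamma>_def) (simp add: algebra_simps)
    qed (use 3 \<open>z' \<noteq> 0\<close> that in simp_all)
    ultimately show ?thesis by auto
  qed
qed

text \<open>Outside H_J every nilpotent endomorphism squares to zero, so its (1,2) and (2,3) entries
  satisfy x z = 0. Such pairs (x, z) are closed under addition and hence fill at most a line: beyond
  1 and \<open>E13\<close> there is at most one generator, and if there is one,
  \<open>degeneration_of_orbit_J3\<close> supplies the curve.\<close>

lemma End_rep_E13_cases:
  fixes m :: "'a::alg_closed_field^3^3^'r"
  assumes ind: "indecomposable_rep (rep m)" and E: "(E13, E13) \<in> End_rep (rep m)"
    and notJ: "\<not> orbit J3 m"
  shows "mat_pair.dim (End_rep (rep m)) \<le> 3 \<and> (mat_pair.dim (End_rep (rep m)) \<le> 2 \<or>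
    (\<exists>\<gamma>. poly_curve \<gamma> \<and> \<gamma> 0 = m \<and> (\<forall>t. t \<noteq> 0 \<longrightarrow> orbit J3 (\<gamma> t))))"
proof -
  have zero: "X = 0 \<longleftrightarrow> Y = 0" if "(X, Y) \<in> End_rep (rep m)" for X Y
    using that indecomposable_End_left_0[OF ind, of Y] indecomposable_End_right_0[OF ind, of X] by auto
  have sq: "X ** X = 0 \<and> Y ** Y = 0"
    if "(X, Y) \<in> End_rep (rep m)" "X ** X ** X = 0" "Y ** Y ** Y = 0" for X Y
    using orbit_J3[OF that] notJ zero[OF End_rep_mult[OF that(1) that(1)]] by auto
  have nil: "\<exists>x y z x' y' z'. A = mat33 0 x y 0 0 z 0 0 0 \<and> B = mat33 0 x' y' 0 0 z' 0 0 0 \<and> x * z = 0"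
    if AB: "(A, B) \<in> End_rep (rep m)" "A ** A ** A = 0" "B ** B ** B = 0" for A B
  proof -
    have "(E13 + A, E13 + B) \<in> End_rep (rep m)"
      by (intro End_rep_add E AB)
    then obtain c where "(E13 + A - mat c) ** (E13 + A - mat c) ** (E13 + A - mat c) = 0"
      "(E13 + B - mat c) ** (E13 + B - mat c) ** (E13 + B - mat c) = 0"
      using indecomposable_endo[OF ind] by metis
    then have c: "(E13 + A - mat c) ** (E13 + A - mat c) = 0" "(E13 + B - mat c) ** (E13 + B - mat c) = 0"
      using sq[of "E13 + A - mat c" "E13 + B - mat c"] \<open>(E13 + A, E13 + B) \<in> End_rep (rep m)\<close>
      by (simp_all add: End_rep_diff End_rep_scalar)
    have "A ** A = 0" "B ** B = 0"
      using sq[OF AB] by auto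
    then obtain x y z x' y' z' where "A = mat33 0 x y 0 0 z 0 0 0" "x * z = 0" "B = mat33 0 x' y' 0 0 z' 0 0 0"
      using square_zero_pair_form[OF _ c(1)] square_zero_pair_form[OF _ c(2)] by metis
    then show ?thesis by auto
  qed
  have dec: "\<exists>c x y z x' y' z'. A = mat c + mat33 0 x y 0 0 z 0 0 0 \<and> B = mat c + mat33 0 x' y' 0 0 z' 0 0 0 \<and>
      x * z = 0 \<and> (mat33 0 x y 0 0 z 0 0 0, mat33 0 x' y' 0 0 z' 0 0 0) \<in> End_rep (rep m)"
    if AB: "(A, B) \<in> End_rep (rep m)" for A B
  proof -
    obtain c where c: "(A - mat c) ** (A - mat c) ** (A - mat c) = 0"
      "(B - mat c) ** (B - mat c) ** (B - mat c) = 0"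
      using indecomposable_endo[OF ind AB] by metis
    have diff: "(A - mat c, B - mat c) \<in> End_rep (rep m)"
      by (intro End_rep_diff AB End_rep_scalar)
    obtain x y z x' y' z' where *: "A - mat c = mat33 0 x y 0 0 z 0 0 0" "B - mat c = mat33 0 x' y' 0 0 z' 0 0 0"
      "x * z = 0"
      using nil[OF diff c] by auto
    moreover have "A = mat c + (A - mat c)" "B = mat c + (B - mat c)"
      by simp_all
    ultimately show ?thesis
      using diff by metis
  qed
  have yE: "(mat33 0 0 y 0 0 0 0 0 0, mat33 0 0 y 0 0 0 0 0 0) \<in> End_rep (rep m)" for y
    using End_rep_mult[OF End_rep_scalar[of y] E] by (simp add: mat_mat33 E13_def)
  have "\<exists>c p q d r. m $ a = mat33 c p q 0 d r 0 0 c" for a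
  proof -
    obtain x1 x2 x3 x4 x5 x6 x7 x8 x9 where "m $ a = mat33 x1 x2 x3 x4 x5 x6 x7 x8 x9"
      by (rule mat33_exhaust)
    then show ?thesis
      using End_rep_commute[OF E, of a] by (simp add: E13_def)
  qed
  then obtain c p q d r where m: "m $ a = mat33 (c a) (p a) (q a) 0 (d a) (r a) 0 0 (c a)" for a
    by metis
  have "\<exists>a. c a \<noteq> 0"
  proof (rule ccontr)
    assume "\<not> ?thesis"
    then have "(mat33 1 0 0 0 0 0 0 0 0, 0) \<in> End_rep (rep m)"
      by (simp add: End_rep_iff m zero_mat33)
    then show False
      using indecomposable_End_right_0[OF ind] by (force simp: zero_mat33)
  qed
  then obtain a0 where a0: "c a0 \<noteq> 0" by auto
  show ?thesis
  proof (cases "\<exists>x y z x' y' z'. (mat33 0 x y 0 0 z 0 0 0, mat33 0 x' y' 0 0 z' 0 0 0) \<in> End_rep (rep m) \<and>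
      x * z = 0 \<and> (x \<noteq> 0 \<or> z \<noteq> 0)")
    case True
    then obtain x y z x' y' z' where
      psi: "(mat33 0 x y 0 0 z 0 0 0, mat33 0 x' y' 0 0 z' 0 0 0) \<in> End_rep (rep m)"
      and xz: "x * z = 0" "x \<noteq> 0 \<or> z \<noteq> 0"
      by auto
    have "\<exists>a b s. A = mat a ** mat 1 + mat b ** E13 + mat s ** mat33 0 x y 0 0 z 0 0 0 \<and>
        B = mat a ** mat 1 + mat b ** E13 + mat s ** mat33 0 x' y' 0 0 z' 0 0 0"
      if AB: "(A, B) \<in> End_rep (rep m)" for A B
    proof -
      obtain k u v w u' v' w' where k: "A = mat k + mat33 0 u v 0 0 w 0 0 0" "B = mat k + mat33 0 u' v' 0 0 w' 0 0 0"
        "u * w = 0" "(mat33 0 u v 0 0 w 0 0 0, mat33 0 u' v' 0 0 w' 0 0 0) \<in> End_rep (rep m)"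
        using dec[OF AB] by auto
      \<comment> \<open>The products vanish for both endomorphisms and for their sum, so (u, w) is a
        multiple of (x, z).\<close>
      have "(x + u) * (z + w) = 0"
        using nil[OF End_rep_add[OF psi k(4)]] by (simp add: zero_mat33)
      then obtain s where s: "u = s * x" "w = s * z"
      proof (cases "x = 0")
        case True
        then have "u = 0"
          using \<open>(x + u) * (z + w) = 0\<close> xz k(3) by auto
        then show ?thesis
          using that[of "w / z"] True xz by simp
      next
        case False
        then have "w = 0" "z = 0"
          using \<open>(x + u) * (z + w) = 0\<close> xz k(3) by auto
        then show ?thesis
          using that[of "u / x"] False by simp
      qed
      \<comment> \<open>Subtracting s times the chosen endomorphism and a multiple of
        \<open>E13\<close> leaves one that vanishes at the source, hence at the target too.\<close>
      have "(mat s ** mat33 0 x y 0 0 z 0 0 0, mat s ** mat33 0 x' y' 0 0 z' 0 0 0) \<in> End_rep (rep m)"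
        by (intro End_rep_mult End_rep_scalar psi)
      from End_rep_diff[OF End_rep_diff[OF k(4) this] yE[of "v - s * y"]]
      have "(0, mat33 0 (u' - s * x') (v' - s * y' - (v - s * y)) 0 0 (w' - s * z') 0 0 0) \<in> End_rep (rep m)"
        by (simp add: mat_mat33 zero_mat33 s)
      then have "u' = s * x'" "v' = s * y' + (v - s * y)" "w' = s * z'"
        using indecomposable_End_left_0[OF ind] by (force simp: zero_mat33 algebra_simps)+
      then show ?thesis
        by - (rule exI[of _ k], rule exI[of _ "v - s * y"], rule exI[of _ s],
          simp add: k s mat_mat33 E13_def algebra_simps)
    qed
    then have "mat_pair.dim (End_rep (rep m)) \<le> card {(mat 1 :: 'a^3^3, mat 1 :: 'a^3^3), (E13, E13),
        (mat33 0 x y 0 0 z 0 0 0, mat33 0 x' y' 0 0 z' 0 0 0)}"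
      by (rule dim_End_le3)
    also have "\<dots> \<le> 3"
      by (simp add: card_insert_if)
    finally show ?thesis
      using degeneration_of_orbit_J3[OF ind m a0 psi xz] by simp
  next
    case False
    have "\<exists>a b s. A = mat a ** mat 1 + mat b ** E13 + mat s ** E13 \<and> B = mat a ** mat 1 + mat b ** E13 + mat s ** E13"
      if AB: "(A, B) \<in> End_rep (rep m)" for A B
    proof -
      obtain k u v w u' v' w' where k: "A = mat k + mat33 0 u v 0 0 w 0 0 0" "B = mat k + mat33 0 u' v' 0 0 w' 0 0 0"
        "u * w = 0" "(mat33 0 u v 0 0 w 0 0 0, mat33 0 u' v' 0 0 w' 0 0 0) \<in> End_rep (rep m)"
        using dec[OF AB] by auto
      then have uw: "u = 0" "w = 0"
        using False by metis+
      from End_rep_diff[OF k(4) yE[of v]]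
      have "(0, mat33 0 u' (v' - v) 0 0 w' 0 0 0) \<in> End_rep (rep m)"
        by (simp add: zero_mat33 uw)
      then have "u' = 0" "v' = v" "w' = 0"
        using indecomposable_End_left_0[OF ind] by (force simp: zero_mat33)+
      then show ?thesis
        by - (rule exI[of _ k], rule exI[of _ v], rule exI[of _ 0], simp add: k uw mat_mat33 E13_def zero_mat33)
    qed
    then have "mat_pair.dim (End_rep (rep m)) \<le> card {(mat 1 :: 'a^3^3, mat 1 :: 'a^3^3), (E13, E13), (E13, E13)}"
      by (rule dim_End_le3)
    also have "\<dots> \<le> 2"
      by (simp add: card_insert_if)
    finally show ?thesis by simp
  qed
qed

lemma poly_curve_act:
  assumes "poly_curve \<gamma>"
  shows "poly_curve (\<lambda>t. act Q P (\<gamma> t))"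
  using assms unfolding poly_curve_def act_def
  by (simp add: is_poly_matrix_mult is_poly_const)

text \<open>Points of H_J take the constant curve. The others with more than scalar endomorphisms
  are moved by base change to a triple commuting with \<open>E13\<close>, and the curve found there
  is moved back.\<close>

lemma indecomposable_degeneration:
  fixes m :: "'a::alg_closed_field^3^3^'r"
  assumes ind: "indecomposable_rep (rep m)"
  shows "mat_pair.dim (End_rep (rep m)) \<le> 3 \<and> (mat_pair.dim (End_rep (rep m)) \<le> 2 \<or>
    (\<exists>\<gamma>. poly_curve \<gamma> \<and> \<gamma> 0 = m \<and> (\<forall>t. t \<noteq> 0 \<longrightarrow> orbit J3 (\<gamma> t))))"
proof (cases "orbit J3 m \<or> mat_pair.dim (End_rep (rep m)) \<le> 1")
  case True
  moreover have "poly_curve (\<lambda>t. m)"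
    by (simp add: poly_curve_def is_poly_const)
  ultimately show ?thesis
    using dim_End_le3_orbit_J3[OF ind] by (auto intro: exI[of _ "\<lambda>t. m"])
next
  case False
  then have "orbit E13 m"
    using dim_le_1_or_orbit_E13[OF ind] by simp
  then obtain Q P m' where *: "invertible Q" "invertible P" "m = act Q P m'" and E: "(E13, E13) \<in> End_rep (rep m')"
    unfolding orbit_def by auto
  obtain Q' P' where "invertible Q'" "invertible P'" "act Q' P' m = m'"
    using act_inverse[OF *(1,2)] *(3) by metis
  then have ind': "indecomposable_rep (rep m')"
    using indecomposable_act ind by metis
  have "\<not> orbit J3 m'"
    using orbit_act *(1-3) False by auto
  from End_rep_E13_cases[OF ind' E this] show ?thesis
  proof (elim conjE disjE exE)
    assume "mat_pair.dim (End_rep (rep m')) \<le> 2"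
    then show ?thesis
      using * by (simp add: dim_End_act)
  next
    fix \<gamma> assume "poly_curve \<gamma>" "\<gamma> 0 = m'" "\<forall>t. t \<noteq> 0 \<longrightarrow> orbit J3 (\<gamma> t)"
      "mat_pair.dim (End_rep (rep m')) \<le> 3"
    then show ?thesis
      using * poly_curve_act[of \<gamma> Q P] orbit_act[OF *(1,2)]
      by (auto simp: dim_End_act intro!: exI[of _ "\<lambda>t. act Q P (\<gamma> t)"])
  qed
qed

section \<open>Irreducibility\<close>

text \<open>The identity arrow forces A = B, and the other two arrows generate the full matrix
  algebra, whose commutant is scalar.\<close>

lemma dim_End_example_1:
  "mat_pair.dim (End_rep (rep (vector [mat 1, J3, mat33 0 0 0 0 0 0 1 0 0] :: 'a::field^3^3^3))) \<le> 1"
proof -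
  let ?m = "vector [mat 1, J3, mat33 0 0 0 0 0 0 1 0 0] :: 'a^3^3^3"
  have "\<exists>a b c. A = mat a ** mat 1 + mat b ** mat 1 + mat c ** mat 1 \<and>
      B = mat a ** mat 1 + mat b ** mat 1 + mat c ** mat 1"
    if AB: "(A, B) \<in> End_rep (rep ?m)" for A B
  proof -
    obtain x1 x2 x3 x4 x5 x6 x7 x8 x9 where A: "A = mat33 x1 x2 x3 x4 x5 x6 x7 x8 x9"
      by (rule mat33_exhaust)
    obtain y1 y2 y3 y4 y5 y6 y7 y8 y9 where B: "B = mat33 y1 y2 y3 y4 y5 y6 y7 y8 y9"
      by (rule mat33_exhaust)
    show ?thesis
      by (rule exI[of _ x1], rule exI[of _ 0], rule exI[of _ 0])
        (use AB in \<open>auto simp: End_rep_iff forall_3 A B J3_def mat_mat33\<close>)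
  qed
  from dim_End_le3[of ?m, OF this] show ?thesis by simp
qed

text \<open>The first two arrows sum to the identity, so A = B; among the polynomials in
  \<open>J3\<close>, commuting with the second arrow removes the \<open>J3\<close> term.\<close>

lemma dim_End_example_2:
  fixes m :: "'a::field^3^3^3"
  defines "m \<equiv> vector [mat33 1 0 0 0 0 0 0 0 1, mat33 0 0 0 0 1 0 0 0 0, J3]"
  shows "(E13, E13) \<in> End_rep (rep m)" "mat_pair.dim (End_rep (rep m)) \<le> 2"
proof -
  show "(E13, E13) \<in> End_rep (rep m)"
    by (simp add: End_rep_iff forall_3 m_def J3_def E13_def)
  have "\<exists>a b c. A = mat a ** mat 1 + mat b ** E13 + mat c ** E13 \<and>
      B = mat a ** mat 1 + mat b ** E13 + mat c ** E13"
    if AB: "(A, B) \<in> End_rep (rep m)" for A B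
  proof -
    obtain x1 x2 x3 x4 x5 x6 x7 x8 x9 where A: "A = mat33 x1 x2 x3 x4 x5 x6 x7 x8 x9"
      by (rule mat33_exhaust)
    obtain y1 y2 y3 y4 y5 y6 y7 y8 y9 where B: "B = mat33 y1 y2 y3 y4 y5 y6 y7 y8 y9"
      by (rule mat33_exhaust)
    show ?thesis
      by (rule exI[of _ x1], rule exI[of _ x3], rule exI[of _ 0])
        (use AB in \<open>auto simp: End_rep_iff forall_3 A B m_def J3_def E13_def mat_mat33\<close>)
  qed
  from dim_End_le3[of m, OF this] have "mat_pair.dim (End_rep (rep m)) \<le>
      card {(mat 1 :: 'a^3^3, mat 1 :: 'a^3^3), (E13, E13), (E13, E13)}"
    by simp
  also have "\<dots> \<le> 2"
    by (simp add: card_insert_if)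
  finally show "mat_pair.dim (End_rep (rep m)) \<le> 2" .
qed

text \<open>The identity arrow forces A = B, and the commutant of \<open>J3\<close> consists of the
  polynomials in \<open>J3\<close>.\<close>

lemma dim_End_example_3:
  fixes m :: "'a::field^3^3^3"
  defines "m \<equiv> vector [mat 1, J3, 0]"
  shows "(J3, J3) \<in> End_rep (rep m)" "mat_pair.dim (End_rep (rep m)) \<le> 3"
proof -
  show "(J3, J3) \<in> End_rep (rep m)"
    by (simp add: End_rep_iff forall_3 m_def J3_def zero_mat33)
  have "\<exists>a b c. A = mat a ** mat 1 + mat b ** J3 + mat c ** (J3 ** J3) \<and>
      B = mat a ** mat 1 + mat b ** J3 + mat c ** (J3 ** J3)"
    if AB: "(A, B) \<in> End_rep (rep m)" for A B
  proof -
    obtain x1 x2 x3 x4 x5 x6 x7 x8 x9 where A: "A = mat33 x1 x2 x3 x4 x5 x6 x7 x8 x9"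
      by (rule mat33_exhaust)
    obtain y1 y2 y3 y4 y5 y6 y7 y8 y9 where B: "B = mat33 y1 y2 y3 y4 y5 y6 y7 y8 y9"
      by (rule mat33_exhaust)
    show ?thesis
      by (rule exI[of _ x1], rule exI[of _ x2], rule exI[of _ x3])
        (use AB in \<open>auto simp: End_rep_iff forall_3 A B m_def J3_def mat_mat33 zero_mat33\<close>)
  qed
  from dim_End_le3[of m, OF this] have "mat_pair.dim (End_rep (rep m)) \<le>
      card {(mat 1 :: 'a^3^3, mat 1 :: 'a^3^3), (J3, J3), (J3 ** J3, J3 ** J3)}"
    by simp
  also have "\<dots> \<le> 3"
    by (simp add: card_insert_if)
  finally show "mat_pair.dim (End_rep (rep m)) \<le> 3" .
qed

lemma orbitI: "(N, N) \<in> End_rep (rep m) \<Longrightarrow> orbit N m"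
  unfolding orbit_def
  by (intro exI[of _ "mat 1"] exI[of _ m]) (simp add: act_1 invertible_det_nz)

lemma irreducible_orbit:
  fixes N :: "'a::alg_closed_field^3^3"
  assumes "\<And>m :: 'a^3^3^3. m \<in> S \<longleftrightarrow> orbit N m \<and> mat_pair.dim (End_rep (rep m)) \<le> j" "S \<noteq> {}"
  shows "irreducible_space (subtopology zariski S)"
proof -
  have S: "S = {m. orbit N m \<and> mat_pair.dim (End_rep (rep m)) \<le> j}"
    using assms(1) by auto
  show ?thesis
  proof (rule irreducible_space_by_curves[of S])
    show conn: "\<exists>\<gamma>. poly_curve \<gamma> \<and> \<gamma> 0 = x \<and> \<gamma> 1 = y \<and> finite {t. \<gamma> t \<notin> S}"
      if "x \<in> S" "y \<in> S" for x y
      using that orbit_curve[of N x j y] unfolding S by simp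
    show "\<exists>\<gamma>. poly_curve \<gamma> \<and> \<gamma> 0 = x \<and> finite {t. \<gamma> t \<notin> S}" if "x \<in> S" for x
      using conn[OF that that] by auto
  qed (use assms(2) in auto)
qed

lemma irreducible_U_Q3_1:
  "irreducible_space (subtopology zariski (U_Q3 1 :: ('a::alg_closed_field^3^3^3) set))"
proof (rule irreducible_orbit[of _ "mat 1" 1])
  \<comment> \<open>Every triple commutes with the identity, so H_1 is the whole space and only the
    dimension bound remains.\<close>
  show "m \<in> U_Q3 1 \<longleftrightarrow> orbit (mat 1) m \<and> mat_pair.dim (End_rep (rep m)) \<le> 1" for m :: "'a^3^3^3"
    using U_Q3_1I[of m] orbitI[OF End_rep_scalar[of 1 m]] by (auto simp: U_Q3_def)
  show "(U_Q3 1 :: ('a^3^3^3) set) \<noteq> {}"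
    using U_Q3_1I[OF dim_End_example_1] by auto
qed

lemma irreducible_U_Q3_2:
  "irreducible_space (subtopology zariski (U_Q3 2 :: ('a::alg_closed_field^3^3^3) set))"
proof (rule irreducible_orbit[of _ "E13" 2])
  \<comment> \<open>Dimension exactly 2 rules out the first alternative of
    \<open>dim_le_1_or_orbit_E13\<close>.\<close>
  show "m \<in> U_Q3 2 \<longleftrightarrow> orbit E13 m \<and> mat_pair.dim (End_rep (rep m)) \<le> 2" for m :: "'a^3^3^3"
    using orbit_U_Q3[of E13 2 m, OF U_Q3_2I] dim_le_1_or_orbit_E13[of m] by (auto simp: U_Q3_def)
  show "(U_Q3 2 :: ('a^3^3^3) set) \<noteq> {}"
    using U_Q3_2I[OF dim_End_example_2] by auto
qed

lemma irreducible_U_Q3_3: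
  "irreducible_space (subtopology zariski (U_Q3 3 :: ('a::alg_closed_field^3^3^3) set))"
proof (rule irreducible_space_by_curves)
  let ?T = "{m :: 'a^3^3^3. orbit J3 m \<and> mat_pair.dim (End_rep (rep m)) \<le> 3}"
  show "?T \<noteq> {}"
    using orbitI[OF dim_End_example_3(1)] dim_End_example_3(2) by auto
  show "?T \<subseteq> U_Q3 3"
    using orbit_U_Q3[OF U_Q3_3I] by auto
  show "\<exists>\<gamma>. poly_curve \<gamma> \<and> \<gamma> 0 = x \<and> \<gamma> 1 = y \<and> finite {t. \<gamma> t \<notin> ?T}"
    if "x \<in> ?T" "y \<in> ?T" for x y
    using that by (intro orbit_curve) simp_all
  show "\<exists>\<gamma>. poly_curve \<gamma> \<and> \<gamma> 0 = x \<and> finite {t. \<gamma> t \<notin> ?T}"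
    if "x \<in> U_Q3 3" for x
  proof -
    have dim: "mat_pair.dim (End_rep (rep x)) = 3" and ind: "indecomposable_rep (rep x)"
      using that by (simp_all add: U_Q3_def)
    obtain \<gamma> where \<gamma>: "poly_curve \<gamma>" "\<gamma> 0 = x" "\<And>t. t \<noteq> 0 \<Longrightarrow> orbit J3 (\<gamma> t)"
      using indecomposable_degeneration[OF ind] dim by auto
    \<comment> \<open>Parameter 0 is excluded because \<open>x\<close> itself need not lie in H_J;
      semicontinuity bounds the dimension at almost all other parameters.\<close>
    have "finite ({0} \<union> {t. \<not> mat_pair.dim (End_rep (rep (\<gamma> t))) \<le> 3})"
      using dim_End_semicontinuous[OF \<gamma>(1), of 3] \<gamma>(2) dim by simp
    then have "finite {t. \<gamma> t \<notin> ?T}"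
      by (rule rev_finite_subset) (use \<gamma>(3) in auto)
    then show ?thesis
      using \<gamma>(1,2) by auto
  qed
qed

theorem mainTheorem5:
  shows "(\<forall>j\<in>{1, 2, 3}.
           irreducible_space (subtopology zariski (U_Q3 j :: ('a::alg_closed_field^3^3^3) set))) \<and>
         (\<forall>j\<ge>4. (U_Q3 j :: ('a^3^3^3) set) = {})"
proof -
  have "(U_Q3 j :: ('a^3^3^3) set) = {}" if "j \<ge> 4" for j
  proof -
    have "m \<notin> U_Q3 j" for m :: "'a^3^3^3"
      using indecomposable_degeneration[of m] that by (auto simp: U_Q3_def)
    then show ?thesis by auto
  qed
  then show ?thesis
    using irreducible_U_Q3_1 irreducible_U_Q3_2 irreducible_U_Q3_3 by simp
qed

end
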